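(* Let $Z_1, Z_2, \ldots$ be independent, identically distributed random vectors in $\mathbb{R}^2$ with $\mathbb{E}[\|Z_1\|^2] < \infty$ and $\|\mathbb{E}[Z_1]\| \neq 0$. Let $S_0 := 0$ and $S_n := \sum_{i=1}^n Z_i$ for $n \geq 1$, and let $L_n$ denote the length of the perimeter of the convex hull of $\{S_0, S_1, \ldots, S_n\}$. Define \[ \sigma^2 := \frac{4\, \mathbb{E}\big[ \big( (Z_1 - \mathbb{E}[Z_1]) \cdot \mathbb{E}[Z_1] \big)^2 \big]}{\|\mathbb{E}[Z_1]\|^2}, \] and suppose $\sigma^2 > 0$. Then for every $x \in \mathbb{R}$, \[ \lim_{n \to \infty} \Pr\left[ \frac{L_n - \mathbb{E}[L_n]}{\sqrt{\operatorname{Var}[L_n]}} \leq x \right] = \lim_{n \to \infty} \Pr\left[ \frac{L_n - \mathbb{E}[L_n]}{\sqrt{\sigma^2 n}} \leq x \right] = \Phi(x), \] where $\Phi$ is the standard normal distribution function.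
   Context: $\cdot$ denotes the Euclidean inner product and $\|\cdot\|$ the Euclidean norm on $\mathbb{R}^2$. *)

theory Defs
  imports "HOL-Analysis.Analysis" "HOL-Probability.Probability"
begin

definition cross2 :: "real^2 \<Rightarrow> real^2 \<Rightarrow> real" where
  "cross2 u v = u$1 * v$2 - u$2 * v$1"

text \<open>Directed boundary edges of the convex hull of a finite plane point set P:
  ordered pairs (a,b) of distinct vertices (extreme points) of the hull such that
  all of P lies in the closed left half-plane of the directed line from a to b.
  For a nondegenerate hull these are exactly the counterclockwise edges; for a
  hull that is a segment [a,b] both orientations occur; for a point there is none.\<close>
definition hull_edges :: "(real^2) set \<Rightarrow> ((real^2) \<times> (real^2)) set" where
  "hull_edges P = {(a, b). a extreme_point_of (convex hull P) \<and>
                          b extreme_point_of (convex hull P) \<and> a \<noteq> b \<and>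
                          (\<forall>p\<in>P. 0 \<le> cross2 (b - a) (p - a))}"

text \<open>Perimeter length of the convex hull (a degenerate segment hull has
  perimeter twice its length, a single point has perimeter 0).\<close>
definition hull_perimeter :: "(real^2) set \<Rightarrow> real" where
  "hull_perimeter P = (\<Sum>(a, b)\<in>hull_edges P. dist a b)"

end

theory Submission
  imports Defs "HOL-Real_Asymp.Real_Asymp"
begin

text \<open>
  The edge vectors of a convex polygon satisfy Cauchy's identity: projected to any direction \<open>e\<close>, their
  absolute lengths add up to twice the width of the polygon in direction \<open>e\<close>. Hence the perimeter is at
  least twice the width in the drift direction \<open>u = \<mu> / \<bar>\<mu>\<bar>\<close>. It is also at most a suitable
  combination of the widths in the three directions \<open>u\<close> and \<open>s u \<plusminus> v\<close> with \<open>v\<close> orthogonal to \<open>u\<close>, which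
  is sharp up to a factor \<open>1 + s\<^sup>2 / 2\<close> on vectors parallel to \<open>u\<close>. In a direction \<open>e\<close> with
  \<open>\<mu> \<bullet> e > 0\<close>, the width of the walk exceeds \<open>S\<^sub>n \<bullet> e\<close> by at most the maxima of two random walks
  with drift \<open>- \<mu> \<bullet> e\<close> (the walk itself and its time reversal). Truncating the increments, Doob's
  inequality for the tails and Hoeffding's inequality for the bounded parts show that with
  \<open>s = n powr (-1/3)\<close> these maxima are \<open>o(sqrt n)\<close> in mean square. So \<open>L\<^sub>n - 2 S\<^sub>n \<bullet> u\<close> is
  \<open>o(sqrt n)\<close> in mean square, and the claim reduces to the central limit theorem for \<open>2 S\<^sub>n \<bullet> u\<close>.
\<close>

subsection \<open>Projections of the edges of a convex polygon\<close>

text \<open>The obstacle is the transverse displacement: at right angles to the drift the walk may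
  fluctuate on the scale \<open>sqrt n\<close>, the scale of the limit theorem itself. Bounding an
  edge by its components along \<open>u\<close> and \<open>v\<close> would leave that much error, so
  the width in direction \<open>v\<close> must not appear. In the directions \<open>s u + v\<close>
  and \<open>s u - v\<close> the walk has the positive drift \<open>s * norm \<mu>\<close>; each
  width is then close to the component of the endpoint of the walk, and in the sum of the two the
  contributions of \<open>v\<close> cancel. The price is a length defect of order
  \<open>s^2 n\<close>. It is below \<open>sqrt n\<close> when \<open>s\<close> is much smaller than
  \<open>n powr (-1/4)\<close>, whereas the excursions against the drift, of order
  \<open>1 / s\<close>, are below \<open>sqrt n\<close> when \<open>s\<close> is much larger than
  \<open>n powr (-1/2)\<close>. The exponent \<open>-1/3\<close> lies in this window. Errors are
  controlled in mean square, not merely in probability, because the theorem centres and scales by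
  the mean and the variance of the perimeter itself, and these have to be compared as well.\<close>

lemma inner_real2: "(u::real^2) \<bullet> v = u$1 * v$1 + u$2 * v$2"
  by (simp add: inner_vec_def sum_2)

lemma cross2_diff_right: "cross2 u (v - w) = cross2 u v - cross2 u w"
  by (simp add: cross2_def algebra_simps)

text \<open>Up to scaling, \<open>v \<bullet> e\<close> and \<open>cross2 e v\<close> are the
  coordinates of \<open>v\<close> in the orthogonal frame of \<open>e\<close>, and the cross product
  is computed in that frame. For the difference of two points on one level line of \<open>e\<close>
  the first coordinate vanishes, so the side of an edge on which a point lies becomes an order of
  positions along the level line.\<close>

lemma cross2_frame:
  "(e \<bullet> e) * cross2 v w = cross2 e w * (v \<bullet> e) - cross2 e v * (w \<bullet> e)"
  by (simp add: cross2_def inner_real2 algebra_simps)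

lemma cross2_zero_parallel:
  assumes "cross2 v w = 0"
  shows "(v \<bullet> e) *\<^sub>R w = (w \<bullet> e) *\<^sub>R v"
proof -
  have *: "v$1 * w$2 = v$2 * w$1" using assms by (simp add: cross2_def)
  have "(v \<bullet> e) * w$1 = (w \<bullet> e) * v$1"
    using * by (simp add: inner_real2 algebra_simps)
  moreover have "(v \<bullet> e) * w$2 = (w \<bullet> e) * v$2"
    using * by (simp add: inner_real2 algebra_simps)
  ultimately show ?thesis by (simp add: vec_eq_iff forall_2)
qed

text \<open>Of three distinct collinear points one lies strictly between the other two, which
  extremality forbids; the position of \<open>k\<close> relative to 0 and 1 tells which one.\<close>

lemma extreme_point_on_line:
  assumes "a extreme_point_of K" "b extreme_point_of K" "c extreme_point_of K"
    and ab: "a \<noteq> b" and c: "c = a + k *\<^sub>R (b - a)"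
  shows "c = a \<or> c = b"
proof (rule ccontr)
  assume neg: "\<not> (c = a \<or> c = b)"
  then have k: "k \<noteq> 0" "k \<noteq> 1" using c by auto
  consider "k < 0" | "0 < k" "k < 1" | "1 < k" using k by linarith
  then show False
  proof cases
    case 1
    have "a = (1 - (- k / (1 - k))) *\<^sub>R c + (- k / (1 - k)) *\<^sub>R b"
    proof -
      have "(1 - k) *\<^sub>R ((1 - (- k / (1 - k))) *\<^sub>R c + (- k / (1 - k)) *\<^sub>R b) = (1 - k) *\<^sub>R a"
        using 1 unfolding c by (simp add: scaleR_add_right scaleR_diff_right field_simps flip: scaleR_add_left)
      then show ?thesis using 1 by simp
    qed
    moreover have "0 < - k / (1 - k)" "- k / (1 - k) < 1" using 1 by (auto simp: field_simps)
    ultimately have "a \<in> open_segment c b" using neg unfolding in_segment by blast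
    then show False using assms(1-3) unfolding extreme_point_of_def by blast
  next
    case 2
    have "c = (1 - k) *\<^sub>R a + k *\<^sub>R b" unfolding c by (simp add: algebra_simps)
    then have "c \<in> open_segment a b" using ab 2 unfolding in_segment by blast
    then show False using assms(1-3) unfolding extreme_point_of_def by blast
  next
    case 3
    have "b = (1 - 1 / k) *\<^sub>R a + (1 / k) *\<^sub>R c"
      unfolding c using 3 by (simp add: algebra_simps)
    moreover have "0 < 1 / k" "1 / k < 1" using 3 by auto
    ultimately have "b \<in> open_segment a c" using neg unfolding in_segment by blast
    then show False using assms(1-3) unfolding extreme_point_of_def by blast
  qed
qed

lemma hull_edges_subset: "hull_edges P \<subseteq> P \<times> P"
  using extreme_points_of_convex_hull[of P] by (auto simp: hull_edges_def)

lemma finite_hull_edges: "finite P \<Longrightarrow> finite (hull_edges P)"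
  using hull_edges_subset finite_subset by blast

text \<open>\<open>p\<close> and \<open>q\<close> are the points at which the two edges meet the
  level line. Each lies weakly left of the other edge, which orders them along the level line in
  both ways, so they agree. Thus \<open>q\<close>, interior to the second edge, lies on the line of
  the first; as \<open>c\<close> and \<open>d\<close> are both weakly left of that line, both are on
  it. Extremality leaves only \<open>a\<close> and \<open>b\<close> for them, and the levels exclude
  the swapped pair.\<close>

lemma hull_edges_crossing_unique:
  assumes ab: "(a, b) \<in> hull_edges P" "a \<bullet> e < t" "t < b \<bullet> e"
    and cd: "(c, d) \<in> hull_edges P" "c \<bullet> e < t" "t < d \<bullet> e"
  shows "a = c \<and> b = d"
proof -
  define k where "k = (t - a \<bullet> e) / ((b - a) \<bullet> e)"
  define l where "l = (t - c \<bullet> e) / ((d - c) \<bullet> e)"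
  define p where "p = a + k *\<^sub>R (b - a)"
  define q where "q = c + l *\<^sub>R (d - c)"
  have k: "0 < k" "k < 1" using ab by (auto simp: k_def inner_diff_left)
  have l: "0 < l" "l < 1" using cd by (auto simp: l_def inner_diff_left)
  have pe: "p \<bullet> e = t" using ab by (simp add: p_def k_def inner_add_left inner_diff_left)
  have qe: "q \<bullet> e = t" using cd by (simp add: q_def l_def inner_add_left inner_diff_left)
  have e: "e \<bullet> e > 0" using ab by auto
  have mem: "a \<in> P" "b \<in> P" "c \<in> P" "d \<in> P"
    using hull_edges_subset ab(1) cd(1) by auto
  have L: "0 \<le> cross2 (b - a) (c - a)" "0 \<le> cross2 (b - a) (d - a)"
    "0 \<le> cross2 (d - c) (a - c)" "0 \<le> cross2 (d - c) (b - c)"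
    using ab(1) cd(1) mem by (auto simp: hull_edges_def)
  have q1: "cross2 (b - a) (q - p) = (1 - l) * cross2 (b - a) (c - a) + l * cross2 (b - a) (d - a)"
    by (simp add: q_def p_def cross2_def algebra_simps)
  have p1: "cross2 (d - c) (p - q) = (1 - k) * cross2 (d - c) (a - c) + k * cross2 (d - c) (b - c)"
    by (simp add: q_def p_def cross2_def algebra_simps)
  have "0 \<le> cross2 (b - a) (q - p)" unfolding q1 using L l by simp
  moreover have "(e \<bullet> e) * cross2 (b - a) (q - p) = cross2 e (q - p) * ((b - a) \<bullet> e)"
    by (subst cross2_frame) (simp add: inner_diff_left[of q p] pe qe)
  ultimately have "0 \<le> cross2 e (q - p) * ((b - a) \<bullet> e)"
    using e by (metis mult_nonneg_nonneg less_eq_real_def)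
  then have s1: "0 \<le> cross2 e (q - p)"
    using ab by (simp add: inner_diff_left zero_le_mult_iff)
  have "0 \<le> cross2 (d - c) (p - q)" unfolding p1 using L k by simp
  moreover have "(e \<bullet> e) * cross2 (d - c) (p - q) = cross2 e (p - q) * ((d - c) \<bullet> e)"
    by (subst cross2_frame) (simp add: inner_diff_left[of p q] pe qe)
  ultimately have "0 \<le> cross2 e (p - q) * ((d - c) \<bullet> e)"
    using e by (metis mult_nonneg_nonneg less_eq_real_def)
  then have "0 \<le> cross2 e (p - q)"
    using cd by (simp add: inner_diff_left zero_le_mult_iff)
  with s1 have "cross2 e (q - p) = 0" by (simp add: cross2_diff_right)
  then have "cross2 (b - a) (q - p) = 0"
    using cross2_frame[of e "b - a" "q - p"] e by (simp add: inner_diff_left[of q p] pe qe)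
  then have par: "cross2 (b - a) (c - a) = 0" "cross2 (b - a) (d - a) = 0"
    unfolding q1 using L l by (auto simp: add_nonneg_eq_0_iff)
  have abe: "(b - a) \<bullet> e > 0" using ab by (simp add: inner_diff_left)
  have on_line: "x = a + (((x - a) \<bullet> e) / ((b - a) \<bullet> e)) *\<^sub>R (b - a)" if "cross2 (b - a) (x - a) = 0" for x
  proof -
    have "((x - a) \<bullet> e) *\<^sub>R (b - a) = ((b - a) \<bullet> e) *\<^sub>R (x - a)"
      using cross2_zero_parallel[OF that, of e] by simp
    then have "(1 / ((b - a) \<bullet> e)) *\<^sub>R (((x - a) \<bullet> e) *\<^sub>R (b - a)) = x - a" using abe by simp
    then show ?thesis by simp
  qed
  have "c = a \<or> c = b"
    by (rule extreme_point_on_line[OF _ _ _ _ on_line[OF par(1)]])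
      (use ab(1) cd(1) in \<open>auto simp: hull_edges_def\<close>)
  moreover have "d = a \<or> d = b"
    by (rule extreme_point_on_line[OF _ _ _ _ on_line[OF par(2)]])
      (use ab(1) cd(1) in \<open>auto simp: hull_edges_def\<close>)
  ultimately show ?thesis using ab cd by auto
qed

text \<open>Among all pairs of vertices separated by the level, the one whose segment crosses it
  furthest to the right, looking along \<open>e\<close>, is an edge: a vertex strictly to its right
  could replace one endpoint and move the crossing further out. The assumption
  \<open>generic\<close> puts every vertex strictly above or below the level, which decides the
  endpoint to be replaced.\<close>

lemma hull_edges_crossing_exists:
  assumes fin: "finite P" and x: "x \<in> P" "x \<bullet> e < t" and y: "y \<in> P" "t < y \<bullet> e"
    and generic: "\<And>p. p \<in> P \<Longrightarrow> p \<bullet> e \<noteq> t"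
  obtains a b where "(a, b) \<in> hull_edges P" "a \<bullet> e < t" "t < b \<bullet> e"
proof -
  define V where "V = {v. v extreme_point_of convex hull P}"
  have VP: "V \<subseteq> P" unfolding V_def using extreme_points_of_convex_hull by blast
  then have finV: "finite V" using fin finite_subset by blast
  \<comment> \<open>Only extreme points can be endpoints in \<open>hull_edges\<close>, so the search
    runs over \<open>V\<close>. Equality of the hulls carries the separation by the level from
    \<open>P\<close> to \<open>V\<close> and, at the end, the half-plane condition back to
    \<open>P\<close>.\<close>
  have hullV: "convex hull P = convex hull V"
    unfolding V_def using Krein_Milman_Minkowski finite_imp_compact_convex_hull[OF fin] convex_convex_hull by blast
  have "\<exists>a\<in>V. a \<bullet> e < t"
  proof (rule ccontr)
    assume "\<not> ?thesis"
    then have "V \<subseteq> {p. e \<bullet> p \<ge> t}" by (auto simp: inner_commute not_less)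
    then have "convex hull V \<subseteq> {p. e \<bullet> p \<ge> t}" by (simp add: hull_minimal convex_halfspace_ge)
    moreover have "x \<in> convex hull V" using x hull_inc hullV by metis
    ultimately show False using x by (auto simp: inner_commute)
  qed
  then obtain a0 where a0: "a0 \<in> V" "a0 \<bullet> e < t" by blast
  have "\<exists>b\<in>V. t < b \<bullet> e"
  proof (rule ccontr)
    assume "\<not> ?thesis"
    then have "V \<subseteq> {p. e \<bullet> p \<le> t}" by (auto simp: inner_commute not_less)
    then have "convex hull V \<subseteq> {p. e \<bullet> p \<le> t}" by (simp add: hull_minimal convex_halfspace_le)
    moreover have "y \<in> convex hull V" using y hull_inc hullV by metis
    ultimately show False using y by (auto simp: inner_commute)
  qed
  then obtain b0 where b0: "b0 \<in> V" "t < b0 \<bullet> e" by blast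
  \<comment> \<open>\<open>f (a, b)\<close> is the position on the level line of its intersection with the segment from \<open>a\<close> to \<open>b\<close>;
    a pair minimizing it is an edge.\<close>
  define C where "C = {(a, b). a \<in> V \<and> b \<in> V \<and> a \<bullet> e < t \<and> t < b \<bullet> e}"
  define f where "f = (\<lambda>(a, b). cross2 e a + (t - a \<bullet> e) / ((b - a) \<bullet> e) * cross2 e (b - a))"
  have "finite C" unfolding C_def by (rule finite_subset[of _ "V \<times> V"]) (use finV in auto)
  moreover have "C \<noteq> {}" using a0 b0 unfolding C_def by auto
  ultimately obtain z where zC: "z \<in> C" and zmin': "\<And>w. w \<in> C \<Longrightarrow> f z \<le> f w"
    using ex_min_if_finite[of "f ` C"] by (force simp: not_less)
  obtain a b where z: "z = (a, b)" by (cases z)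
  have ab: "(a, b) \<in> C" and zmin: "\<And>w. w \<in> C \<Longrightarrow> f (a, b) \<le> f w" using zC zmin' z by auto
  have aV: "a \<in> V" and bV: "b \<in> V" and at: "a \<bullet> e < t" and bt: "t < b \<bullet> e"
    using ab unfolding C_def by auto
  have e: "e \<bullet> e > 0" using at bt by auto
  have D: "(b - a) \<bullet> e > 0" using at bt by (simp add: inner_diff_left)
  have left: "0 \<le> cross2 (b - a) (p - a)" if "p \<in> V" for p
  proof (rule ccontr)
    assume neg: "\<not> ?thesis"
    have "p \<bullet> e \<noteq> t" using generic that VP by blast
    then consider "p \<bullet> e > t" | "p \<bullet> e < t" by linarith
    then show False
    proof cases
      case 1
      then have "f (a, b) \<le> f (a, p)" using zmin that aV at unfolding C_def by auto
      then have "(t - a \<bullet> e) * (cross2 e (b - a) / ((b - a) \<bullet> e)) \<le> (t - a \<bullet> e) * (cross2 e (p - a) / ((p - a) \<bullet> e))"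
        by (simp add: f_def)
      then have "cross2 e (b - a) / ((b - a) \<bullet> e) \<le> cross2 e (p - a) / ((p - a) \<bullet> e)"
        using at by (simp del: times_divide_eq_right add: mult_le_cancel_left)
      moreover have "(p - a) \<bullet> e > 0" using 1 at by (simp add: inner_diff_left)
      ultimately have "cross2 e (b - a) * ((p - a) \<bullet> e) \<le> cross2 e (p - a) * ((b - a) \<bullet> e)"
        using D by (simp add: divide_simps mult.commute split: if_splits)
      then have "0 \<le> (e \<bullet> e) * cross2 (b - a) (p - a)" by (simp add: cross2_frame)
      then show False using neg e by (simp add: zero_le_mult_iff)
    next
      case 2
      have pb: "(b - p) \<bullet> e > 0" using 2 bt by (simp add: inner_diff_left)
      \<comment> \<open>Here the lower endpoint changes, so the crossing is computed from the common
        upper endpoint \<open>b\<close>.\<close>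
      have fb: "f (c, b) = cross2 e b - (b \<bullet> e - t) * (cross2 e (b - c) / ((b - c) \<bullet> e))"
        if "(b - c) \<bullet> e > 0" for c
        using that unfolding f_def inner_diff_left cross2_diff_right
        by (simp add: field_simps)
      have "f (a, b) \<le> f (p, b)" using zmin that bV bt 2 unfolding C_def by auto
      then have "(b \<bullet> e - t) * (cross2 e (b - p) / ((b - p) \<bullet> e)) \<le> (b \<bullet> e - t) * (cross2 e (b - a) / ((b - a) \<bullet> e))"
        using fb[OF D] fb[OF pb] by simp
      then have "cross2 e (b - p) / ((b - p) \<bullet> e) \<le> cross2 e (b - a) / ((b - a) \<bullet> e)"
        using bt by (simp del: times_divide_eq_right add: mult_le_cancel_left)
      then have "cross2 e (b - p) * ((b - a) \<bullet> e) \<le> cross2 e (b - a) * ((b - p) \<bullet> e)"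
        using D pb by (simp add: divide_simps mult.commute split: if_splits)
      then have "0 \<ge> (e \<bullet> e) * cross2 (b - a) (b - p)" by (simp add: cross2_frame)
      then have "0 \<ge> cross2 (b - a) (b - p)" using e by (simp add: mult_le_0_iff)
      moreover have "cross2 (b - a) (b - p) = - cross2 (b - a) (p - a)"
        by (simp add: cross2_def algebra_simps)
      ultimately show False using neg by simp
    qed
  qed
  have "V \<subseteq> {p. 0 \<le> cross2 (b - a) (p - a)}" using left by auto
  moreover have "convex {p. 0 \<le> cross2 (b - a) (p - a)}"
  proof (rule convexI, clarsimp)
    fix p q :: "real^2" and u v :: real
    assume *: "0 \<le> cross2 (b - a) (p - a)" "0 \<le> cross2 (b - a) (q - a)" "0 \<le> u" "0 \<le> v" "u + v = 1"
    have v: "v = 1 - u" using * by simp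
    have "cross2 (b - a) (u *\<^sub>R p + v *\<^sub>R q - a) = u * cross2 (b - a) (p - a) + v * cross2 (b - a) (q - a)"
      unfolding v by (simp add: cross2_def algebra_simps)
    then show "0 \<le> cross2 (b - a) (u *\<^sub>R p + v *\<^sub>R q - a)" using * by simp
  qed
  ultimately have "convex hull V \<subseteq> {p. 0 \<le> cross2 (b - a) (p - a)}" by (simp add: hull_minimal)
  then have "\<forall>p\<in>P. 0 \<le> cross2 (b - a) (p - a)" using hullV hull_subset[of P convex] by auto
  then have "(a, b) \<in> hull_edges P" using aV bV at bt unfolding hull_edges_def V_def by auto
  then show thesis using that at bt by blast
qed

definition width :: "real^2 \<Rightarrow> (real^2) set \<Rightarrow> real" where
  "width e P = Max ((\<lambda>p. p \<bullet> e) ` P) - Min ((\<lambda>p. p \<bullet> e) ` P)"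

lemma width_uminus:
  assumes "finite P" "P \<noteq> {}"
  shows "width (- e) P = width e P"
proof -
  let ?Q = "(\<lambda>p. p \<bullet> e) ` P"
  have eq: "(\<lambda>p. p \<bullet> (- e)) ` P = uminus ` ?Q" by (simp add: image_image)
  have "- Max ?Q = Min (uminus ` ?Q)" "- Min ?Q = Max (uminus ` ?Q)"
    using assms by (auto intro!: minus_Max_eq_Min minus_Min_eq_Max)
  then show ?thesis unfolding width_def eq by linarith
qed

text \<open>Both sides are the integral over \<open>t\<close> of the number of upward edges crossing the level \<open>t\<close>.\<close>

lemma sum_hull_edges_pos_part:
  assumes fin: "finite P" and ne: "P \<noteq> {}"
  shows "(\<Sum>(a, b)\<in>hull_edges P. max 0 ((b - a) \<bullet> e)) = width e P"
proof -
  let ?Q = "(\<lambda>p. p \<bullet> e) ` P"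
  let ?I = "\<lambda>z. indicat_real {fst z \<bullet> e <..< snd z \<bullet> e}"
  have Q: "finite ?Q" "?Q \<noteq> {}" using assms by auto
  have E: "finite (hull_edges P)" using finite_hull_edges[OF fin] .
  have int: "integrable lborel (indicat_real {l<..<u})" for l u :: real
    by (cases "l \<le> u") (auto intro!: integrable_real_indicator)
  have val: "(\<integral>t. indicat_real {l<..<u} t \<partial>lborel) = max 0 (u - l)" for l u :: real
    by (cases "l \<le> u") (auto simp: max_def)
  have "(\<Sum>(a, b)\<in>hull_edges P. max 0 ((b - a) \<bullet> e)) = (\<Sum>z\<in>hull_edges P. \<integral>t. ?I z t \<partial>lborel)"
    by (intro sum.cong refl) (simp only: val inner_diff_left case_prod_beta)
  also have "\<dots> = (\<integral>t. (\<Sum>z\<in>hull_edges P. ?I z t) \<partial>lborel)"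
    by (rule Bochner_Integration.integral_sum[symmetric]) (rule int)
  also have "\<dots> = (\<integral>t. indicator {Min ?Q <..< Max ?Q} t \<partial>lborel)"
  proof (rule integral_cong_AE)
    \<comment> \<open>Existence of a crossing edge needs a level that avoids all points of
      \<open>P\<close>; the finitely many excluded levels do not affect the integral.\<close>
    have "AE t in lborel. t \<notin> ?Q"
      using Q(1) by (intro AE_not_in) (simp add: finite_imp_null_set_lborel)
    then show "AE t in lborel. (\<Sum>z\<in>hull_edges P. ?I z t) = indicator {Min ?Q <..< Max ?Q} t"
    proof eventually_elim
      fix t assume t: "t \<notin> ?Q"
      show "(\<Sum>z\<in>hull_edges P. ?I z t) = indicator {Min ?Q <..< Max ?Q} t"
      proof (cases "t \<in> {Min ?Q <..< Max ?Q}")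
        case True
        obtain x where x: "x \<in> P" "x \<bullet> e = Min ?Q" using Min_in[OF Q] by force
        obtain y where y: "y \<in> P" "y \<bullet> e = Max ?Q" using Max_in[OF Q] by force
        obtain a b where ab: "(a, b) \<in> hull_edges P" "a \<bullet> e < t" "t < b \<bullet> e"
          using hull_edges_crossing_exists[OF fin, of x e t y] x y True t by auto
        have "(\<Sum>z\<in>hull_edges P. ?I z t) = (\<Sum>z\<in>{(a, b)}. ?I z t)"
        proof (rule sum.mono_neutral_right[OF E])
          show "\<forall>z\<in>hull_edges P - {(a, b)}. ?I z t = 0"
            using hull_edges_crossing_unique[OF _ _ _ ab] by (auto simp: indicator_def)
        qed (use ab in auto)
        then show ?thesis using ab True by simp
      next
        case False
        have "?I z t = 0" if "z \<in> hull_edges P" for z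
        proof -
          have "fst z \<in> P" "snd z \<in> P" using that hull_edges_subset[of P] by (auto simp: mem_Times_iff)
          then have "Min ?Q \<le> fst z \<bullet> e" "snd z \<bullet> e \<le> Max ?Q" using Q by auto
          then show ?thesis using False by (auto simp: indicator_def)
        qed
        then show ?thesis using False by simp
      qed
    qed
  qed auto
  also have "\<dots> = width e P" unfolding val width_def using Q by (simp add: Min_le_iff)
  finally show ?thesis .
qed

text \<open>Edges descending along \<open>e\<close> ascend along \<open>- e\<close>, and the width
  is the same in both directions, so the positive and the negative parts contribute one width
  each.\<close>

lemma sum_hull_edges_abs:
  assumes "finite P" "P \<noteq> {}"
  shows "(\<Sum>(a, b)\<in>hull_edges P. \<bar>(b - a) \<bullet> e\<bar>) = 2 * width e P"
proof -
  have "(\<Sum>(a, b)\<in>hull_edges P. \<bar>(b - a) \<bullet> e\<bar>)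
    = (\<Sum>(a, b)\<in>hull_edges P. max 0 ((b - a) \<bullet> e)) + (\<Sum>(a, b)\<in>hull_edges P. max 0 ((b - a) \<bullet> (- e)))"
    unfolding sum.distrib[symmetric] by (intro sum.cong) (auto simp: max_def)
  then show ?thesis
    unfolding sum_hull_edges_pos_part[OF assms] width_uminus[OF assms] by simp
qed

subsection \<open>Perimeter and widths\<close>

lemma perimeter_ge_width:
  assumes P: "finite P" "P \<noteq> {}" and e: "norm e = 1"
  shows "2 * width e P \<le> hull_perimeter P"
  unfolding hull_perimeter_def sum_hull_edges_abs[OF P, symmetric]
proof (rule sum_mono, clarify)
  fix a b :: "real^2"
  show "\<bar>(b - a) \<bullet> e\<bar> \<le> dist a b"
    using Cauchy_Schwarz_ineq2[of "b - a" e] e by (simp add: dist_norm norm_minus_commute)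
qed

lemma norm_real2: "(norm (u::real^2))\<^sup>2 = (u$1)\<^sup>2 + (u$2)\<^sup>2"
  by (simp only: power2_norm_eq_inner) (simp add: inner_real2 power2_eq_square)

definition perp :: "real^2 \<Rightarrow> real^2" where
  "perp u = vector [- u$2, u$1]"

lemma norm_perp_decomp:
  assumes "norm u = 1"
  shows "(norm v)\<^sup>2 = (v \<bullet> u)\<^sup>2 + (v \<bullet> perp u)\<^sup>2"
proof -
  have u: "(u$1)\<^sup>2 + (u$2)\<^sup>2 = 1"
    using assms norm_real2[of u] by simp
  have "(v \<bullet> u)\<^sup>2 + (v \<bullet> perp u)\<^sup>2 = ((v$1)\<^sup>2 + (v$2)\<^sup>2) * ((u$1)\<^sup>2 + (u$2)\<^sup>2)"
    by (simp add: perp_def inner_real2 power2_eq_square algebra_simps)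
  then show ?thesis unfolding u norm_real2 by simp
qed

lemma norm_perp: "norm (perp u) = norm u"
  by (simp add: norm_eq_sqrt_inner inner_real2 perp_def add.commute)

lemma inner_perp_self: "u \<bullet> perp u = 0"
  by (simp add: inner_real2 perp_def)

text \<open>With \<open>x\<close> and \<open>y\<close> the absolute coordinates of \<open>v\<close>,
  the two tilted terms add up to \<open>2 * max (s * x) y\<close>. The coefficient \<open>q\<close>
  is fixed by \<open>q + s = 1 + s\<^sup>2 / 2\<close>, an upper bound of
  \<open>sqrt (1 + s\<^sup>2)\<close>, which settles the case \<open>y \<le> s * x\<close>. For
  larger \<open>y\<close> the term \<open>y\<^sup>2\<close> cancels and the remaining cross term is
  smallest at \<open>y = s * x\<close>, so the same computation suffices.\<close>

lemma norm_le_three_widths: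
  assumes u: "norm u = 1" and s: "0 \<le> s" "s \<le> 1"
  shows "2 * norm v \<le> 2 * (1 + s\<^sup>2 / 2 - s) * \<bar>v \<bullet> u\<bar>
    + \<bar>v \<bullet> (s *\<^sub>R u + perp u)\<bar> + \<bar>v \<bullet> (s *\<^sub>R u - perp u)\<bar>"
proof -
  define x where "x = \<bar>v \<bullet> u\<bar>"
  define y where "y = \<bar>v \<bullet> perp u\<bar>"
  define q where "q = 1 + s\<^sup>2 / 2 - s"
  have q: "q \<ge> 0" using s zero_le_power2[of s] unfolding q_def by linarith
  have xy: "x \<ge> 0" "y \<ge> 0" by (auto simp: x_def y_def)
  have n: "norm v = sqrt (x\<^sup>2 + y\<^sup>2)"
    by (rule real_sqrt_unique[symmetric]) (simp_all add: x_def y_def norm_perp_decomp[OF u, of v])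
  have m: "\<bar>v \<bullet> (s *\<^sub>R u + perp u)\<bar> + \<bar>v \<bullet> (s *\<^sub>R u - perp u)\<bar> = 2 * max (s * x) y"
  proof -
    have "\<bar>a + b\<bar> + \<bar>a - b\<bar> = 2 * max \<bar>a\<bar> \<bar>b\<bar>" for a b :: real by (simp add: max_def abs_if)
    from this[of "s * (v \<bullet> u)" "v \<bullet> perp u"] show ?thesis
      using s by (simp add: x_def y_def inner_add_right inner_diff_right abs_mult)
  qed
  have "sqrt (x\<^sup>2 + y\<^sup>2) \<le> q * x + max (s * x) y"
  proof (rule real_le_lsqrt)
    show "0 \<le> q * x + max (s * x) y" using q xy by (simp add: add_nonneg_nonneg le_max_iff_disj)
    show "x\<^sup>2 + y\<^sup>2 \<le> (q * x + max (s * x) y)\<^sup>2"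
    proof (cases "y \<le> s * x")
      case True
      then have "y\<^sup>2 \<le> (s * x)\<^sup>2" using xy by (intro power_mono) auto
      moreover have "x\<^sup>2 + (s * x)\<^sup>2 \<le> (q * x + s * x)\<^sup>2"
      proof -
        have "(q * x + s * x)\<^sup>2 - (x\<^sup>2 + (s * x)\<^sup>2) = (s\<^sup>2 / 2 * x)\<^sup>2"
          by (simp add: q_def power2_eq_square algebra_simps)
        then show ?thesis using zero_le_power2[of "s\<^sup>2 / 2 * x"] by linarith
      qed
      ultimately show ?thesis using True by (simp add: max_def)
    next
      case False
      have "2 * q * x * (s * x) \<le> 2 * q * x * y"
        using False q xy by (intro mult_left_mono) auto
      moreover have "x\<^sup>2 \<le> (q * x)\<^sup>2 + 2 * q * x * (s * x)"
      proof -
        have "(q * x)\<^sup>2 + 2 * q * x * (s * x) - x\<^sup>2 = (s\<^sup>2 / 2 * x)\<^sup>2"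
          by (simp add: q_def power2_eq_square algebra_simps)
        then show ?thesis using zero_le_power2[of "s\<^sup>2 / 2 * x"] by linarith
      qed
      ultimately have "x\<^sup>2 + y\<^sup>2 \<le> (q * x + y)\<^sup>2" by (simp add: power2_sum)
      then show ?thesis using False by (simp add: max_def)
    qed
  qed
  then show ?thesis using m unfolding n q_def[symmetric] x_def[symmetric] by linarith
qed

lemma perimeter_le_three_widths:
  assumes P: "finite P" "P \<noteq> {}" and u: "norm u = 1" and s: "0 \<le> s" "s \<le> 1"
  shows "hull_perimeter P \<le> 2 * (1 + s\<^sup>2 / 2 - s) * width u P
    + width (s *\<^sub>R u + perp u) P + width (s *\<^sub>R u - perp u) P"
proof -
  let ?E = "hull_edges P" and ?p = "s *\<^sub>R u + perp u" and ?m = "s *\<^sub>R u - perp u"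
  have "2 * hull_perimeter P = (\<Sum>(a, b)\<in>?E. 2 * norm (b - a))"
    by (simp add: hull_perimeter_def sum_distrib_left dist_norm norm_minus_commute case_prod_beta)
  also have "\<dots> \<le> (\<Sum>(a, b)\<in>?E. 2 * (1 + s\<^sup>2 / 2 - s) * \<bar>(b - a) \<bullet> u\<bar> + \<bar>(b - a) \<bullet> ?p\<bar> + \<bar>(b - a) \<bullet> ?m\<bar>)"
    by (rule sum_mono) (use norm_le_three_widths[OF u s] in auto)
  also have "\<dots> = 2 * (1 + s\<^sup>2 / 2 - s) * (\<Sum>(a, b)\<in>?E. \<bar>(b - a) \<bullet> u\<bar>)
     + (\<Sum>(a, b)\<in>?E. \<bar>(b - a) \<bullet> ?p\<bar>) + (\<Sum>(a, b)\<in>?E. \<bar>(b - a) \<bullet> ?m\<bar>)"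
    unfolding sum_distrib_left sum.distrib[symmetric] by (intro sum.cong) auto
  finally show ?thesis unfolding sum_hull_edges_abs[OF P] by simp
qed

section \<open>Cauchy's perimeter formula and measurability of the perimeter\<close>

definition dir :: "real \<Rightarrow> real^2" where
  "dir \<theta> = cos \<theta> *\<^sub>R axis 1 1 + sin \<theta> *\<^sub>R axis 2 1"

lemma dir_nth [simp]: "dir \<theta> $ 1 = cos \<theta>" "dir \<theta> $ 2 = sin \<theta>"
  by (simp_all add: dir_def axis_def)

lemma has_integral_abs_sin_shift:
  assumes "0 \<le> \<phi>" "\<phi> \<le> pi"
  shows "((\<lambda>\<theta>. \<bar>sin (\<theta> - \<phi>)\<bar>) has_integral 2) {0..pi}"
proof -
  have "((\<lambda>\<theta>. \<bar>sin (\<theta> - \<phi>)\<bar>) has_integral (cos (\<phi> - \<phi>) - cos (0 - \<phi>))) {0..\<phi>}"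
  proof (rule has_integral_eq[rotated])
    show "((\<lambda>\<theta>. - sin (\<theta> - \<phi>)) has_integral (cos (\<phi> - \<phi>) - cos (0 - \<phi>))) {0..\<phi>}"
      using assms by (intro fundamental_theorem_of_calculus)
        (auto intro!: derivative_eq_intros simp flip: has_real_derivative_iff_has_vector_derivative)
    show "- sin (\<theta> - \<phi>) = \<bar>sin (\<theta> - \<phi>)\<bar>" if "\<theta> \<in> {0..\<phi>}" for \<theta>
      using that assms sin_ge_zero[of "\<phi> - \<theta>"] sin_minus[of "\<phi> - \<theta>"] by auto
  qed
  moreover have "((\<lambda>\<theta>. \<bar>sin (\<theta> - \<phi>)\<bar>) has_integral (- cos (pi - \<phi>) - - cos (\<phi> - \<phi>))) {\<phi>..pi}"
  proof (rule has_integral_eq[rotated])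
    show "((\<lambda>\<theta>. sin (\<theta> - \<phi>)) has_integral (- cos (pi - \<phi>) - - cos (\<phi> - \<phi>))) {\<phi>..pi}"
      using assms by (intro fundamental_theorem_of_calculus)
        (auto intro!: derivative_eq_intros simp flip: has_real_derivative_iff_has_vector_derivative)
    show "sin (\<theta> - \<phi>) = \<bar>sin (\<theta> - \<phi>)\<bar>" if "\<theta> \<in> {\<phi>..pi}" for \<theta>
      using that assms sin_ge_zero[of "\<theta> - \<phi>"] by auto
  qed
  ultimately have "((\<lambda>\<theta>. \<bar>sin (\<theta> - \<phi>)\<bar>) has_integral
     ((cos (\<phi> - \<phi>) - cos (0 - \<phi>)) + (- cos (pi - \<phi>) - - cos (\<phi> - \<phi>)))) {0..pi}"
    by (rule has_integral_combine[rotated 2]) (use assms in auto)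
  then show ?thesis by (simp add: cos_diff)
qed

lemma has_integral_abs_inner_dir:
  "((\<lambda>\<theta>. \<bar>v \<bullet> dir \<theta>\<bar>) has_integral 2 * norm v) {0..pi}"
proof -
  \<comment> \<open>For \<open>w$1 \<le> 0\<close> the phase is an \<open>arccos\<close>, hence in
    \<open>{0..pi}\<close>, and its sine \<open>- w$1 / r\<close> has the right sign; the other
    vectors are covered by \<open>- v\<close>, as only the absolute value enters.\<close>
  have *: "((\<lambda>\<theta>. \<bar>w \<bullet> dir \<theta>\<bar>) has_integral 2 * norm w) {0..pi}" if w: "w$1 \<le> 0" for w :: "real^2"
  proof (cases "w = 0")
    case False
    define r where "r = norm w"
    define \<phi> where "\<phi> = arccos (w$2 / r)"
    have r: "r > 0" using False by (simp add: r_def)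
    have r2: "r\<^sup>2 = (w$1)\<^sup>2 + (w$2)\<^sup>2"
      by (simp add: r_def norm_real2)
    have bd: "- 1 \<le> w$2 / r" "w$2 / r \<le> 1"
      using component_le_norm_cart[of w 2] r unfolding r_def by (auto simp: field_simps)
    have c: "cos \<phi> = w$2 / r" unfolding \<phi>_def using bd by simp
    have "sin \<phi> = sqrt (1 - (w$2 / r)\<^sup>2)" unfolding \<phi>_def using bd by (simp add: sin_arccos)
    also have "1 - (w$2 / r)\<^sup>2 = (- w$1 / r)\<^sup>2" using r
      by (simp add: power_divide divide_simps) (use r2 in linarith)
    also have "sqrt ((- w$1 / r)\<^sup>2) = - w$1 / r" using w r by simp
    finally have s: "sin \<phi> = - w$1 / r" .
    have "w \<bullet> dir \<theta> = r * sin (\<theta> - \<phi>)" for \<theta>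
    proof -
      have "r * sin (\<theta> - \<phi>) = r * (sin \<theta> * (w$2 / r) - cos \<theta> * (- w$1 / r))"
        by (simp only: sin_diff c s)
      also have "\<dots> = w$2 * sin \<theta> + w$1 * cos \<theta>" using r by (simp add: distrib_left)
      finally show ?thesis by (simp add: inner_real2)
    qed
    then have eq: "\<bar>w \<bullet> dir \<theta>\<bar> = r * \<bar>sin (\<theta> - \<phi>)\<bar>" for \<theta> using r by (simp add: abs_mult)
    have "((\<lambda>\<theta>. r * \<bar>sin (\<theta> - \<phi>)\<bar>) has_integral r * 2) {0..pi}"
      by (intro has_integral_mult_right has_integral_abs_sin_shift)
        (use bd in \<open>auto simp: \<phi>_def arccos_lbound arccos_ubound\<close>)
    then show ?thesis unfolding eq r_def by (simp add: mult.commute)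
  qed auto
  show ?thesis
  proof (cases "v$1 \<le> 0")
    case False
    then show ?thesis using *[of "- v"] by simp
  qed (rule *)
qed

theorem Cauchy_perimeter:
  assumes P: "finite P" "P \<noteq> {}"
  shows "((\<lambda>\<theta>. width (dir \<theta>) P) has_integral hull_perimeter P) {0..pi}"
proof -
  have "((\<lambda>\<theta>. \<Sum>(a, b)\<in>hull_edges P. \<bar>(b - a) \<bullet> dir \<theta>\<bar>) has_integral
      (\<Sum>(a, b)\<in>hull_edges P. 2 * norm (b - a))) {0..pi}"
    unfolding case_prod_beta
    by (intro has_integral_sum finite_hull_edges P has_integral_abs_inner_dir)
  then have "((\<lambda>\<theta>. 2 * width (dir \<theta>) P) has_integral 2 * hull_perimeter P) {0..pi}"
    unfolding sum_hull_edges_abs[OF P]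
    by (simp add: hull_perimeter_def sum_distrib_left dist_norm norm_minus_commute case_prod_beta)
  from has_integral_mult_right[OF this, of "1/2"] show ?thesis by simp
qed

text \<open>The edge set varies with \<omega>, so the defining sum is not visibly measurable. Widths
  are differences of a maximum and a minimum of finitely many measurable functions, jointly
  measurable in \<omega> and the angle, and Cauchy's formula makes the perimeter a parameter
  integral of them.\<close>

lemma measurable_hull_perimeter:
  fixes S :: "nat \<Rightarrow> 'a \<Rightarrow> real^2"
  assumes S[measurable]: "\<And>k. S k \<in> borel_measurable M"
  shows "(\<lambda>\<omega>. hull_perimeter ((\<lambda>k. S k \<omega>) ` {..n})) \<in> borel_measurable M"
proof -
  let ?P = "\<lambda>\<omega>. (\<lambda>k. S k \<omega>) ` {..n}"
  have W: "width e (?P \<omega>) = Max ((\<lambda>k. S k \<omega> \<bullet> e) ` {..n}) - Min ((\<lambda>k. S k \<omega> \<bullet> e) ` {..n})" for e \<omega>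
    by (simp add: width_def image_image)
  have dir[measurable]: "dir \<in> borel_measurable borel"
    by (intro borel_measurable_continuous_onI) (auto simp: dir_def[abs_def] intro!: continuous_intros)
  have m: "(\<lambda>x. width (dir (snd x)) (?P (fst x))) \<in> borel_measurable (M \<Otimes>\<^sub>M lborel)"
    unfolding W by (intro borel_measurable_diff borel_measurable_Max borel_measurable_Min) auto
  have int: "hull_perimeter (?P \<omega>) = enn2real (\<integral>\<^sup>+\<theta>. indicator {0..pi} \<theta> * width (dir \<theta>) (?P \<omega>) \<partial>lborel)" for \<omega>
  proof -
    have "width (dir \<theta>) (?P \<omega>) \<ge> 0" for \<theta>
      unfolding width_def by (simp add: Min_le_iff)
    moreover have "((\<lambda>\<theta>. width (dir \<theta>) (?P \<omega>)) has_integral hull_perimeter (?P \<omega>)) {0..pi}"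
      by (rule Cauchy_perimeter) auto
    ultimately have "(\<integral>\<^sup>+\<theta>. indicator {0..pi} \<theta> * width (dir \<theta>) (?P \<omega>) \<partial>lborel) = ennreal (hull_perimeter (?P \<omega>))"
      by (intro nn_integral_has_integral_lebesgue) auto
    then show ?thesis by (simp add: hull_perimeter_def sum_nonneg case_prod_beta)
  qed
  show ?thesis unfolding int
    by (intro borel_measurable_enn2real lborel.borel_measurable_nn_integral)
      (use m in \<open>simp add: case_prod_beta\<close>)
qed

subsection \<open>Maximal inequalities\<close>

lemma Max_atMost_Suc:
  fixes f :: "nat \<Rightarrow> 'b::linorder"
  shows "Max (f ` {..Suc n}) = max (f (Suc n)) (Max (f ` {..n}))"
  by (simp add: atMost_Suc)

text \<open>This is a pathwise form of Doob's inequality: the sum is a transform of the walk by its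
  running maximum and will have mean zero for independent centred increments. In the induction a
  step that sets no new record gives equality, and a record \<open>t > m\<close> loses
  \<open>(t - m)\<^sup>2 / 2\<close>.\<close>

lemma Doob_pathwise:
  fixes T :: "nat \<Rightarrow> real"
  assumes "T 0 = 0"
  shows "(Max (T ` {..n}))\<^sup>2 / 2 + (\<Sum>k<n. Max (T ` {..k}) * (T (Suc k) - T k)) \<le> Max (T ` {..n}) * T n"
proof (induction n)
  case 0
  then show ?case using assms by simp
next
  case (Suc n)
  define m where "m = Max (T ` {..n})"
  define t where "t = T (Suc n)"
  have "(max t m)\<^sup>2 / 2 + m * (t - T n) + (m * T n - m\<^sup>2 / 2) \<le> max t m * t"
  proof (cases "t \<le> m")
    case True
    then have "max t m = m" by simp
    moreover have "m\<^sup>2 / 2 + m * (t - T n) + (m * T n - m\<^sup>2 / 2) = m * t" by (simp add: algebra_simps)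
    ultimately show ?thesis by simp
  next
    case False
    then have "max t m = t" by simp
    moreover have "t * t - (t\<^sup>2 / 2 + m * (t - T n) + (m * T n - m\<^sup>2 / 2)) = (t - m)\<^sup>2 / 2"
      by (simp add: power2_eq_square field_simps)
    moreover have "0 \<le> (t - m)\<^sup>2 / 2" by simp
    ultimately show ?thesis by (metis diff_ge_0_iff_ge)
  qed
  with Suc show ?case
    unfolding Max_atMost_Suc sum.lessThan_Suc m_def[symmetric] t_def[symmetric] by linarith
qed

lemma integrable_mult_of_squares:
  fixes f g :: "'a \<Rightarrow> real"
  assumes [measurable]: "f \<in> borel_measurable M" "g \<in> borel_measurable M"
    and int: "integrable M (\<lambda>x. (f x)\<^sup>2)" "integrable M (\<lambda>x. (g x)\<^sup>2)"
  shows "integrable M (\<lambda>x. f x * g x)"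
proof (rule Bochner_Integration.integrable_bound)
  show "integrable M (\<lambda>x. (f x)\<^sup>2 + (g x)\<^sup>2)" using int by simp
  show "AE x in M. norm (f x * g x) \<le> norm ((f x)\<^sup>2 + (g x)\<^sup>2)"
  proof (rule AE_I2)
    fix x
    have "0 \<le> (\<bar>f x\<bar> - \<bar>g x\<bar>)\<^sup>2" by simp
    then have "2 * (\<bar>f x\<bar> * \<bar>g x\<bar>) \<le> (f x)\<^sup>2 + (g x)\<^sup>2" by (simp add: power2_diff)
    moreover have "0 \<le> \<bar>f x\<bar> * \<bar>g x\<bar>" by simp
    ultimately have "\<bar>f x * g x\<bar> \<le> (f x)\<^sup>2 + (g x)\<^sup>2" unfolding abs_mult by linarith
    then show "norm (f x * g x) \<le> norm ((f x)\<^sup>2 + (g x)\<^sup>2)" by simp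
  qed
qed simp

lemma integrable_square_add:
  fixes f g :: "'a \<Rightarrow> real"
  assumes [measurable]: "f \<in> borel_measurable M" "g \<in> borel_measurable M"
    and int: "integrable M (\<lambda>x. (f x)\<^sup>2)" "integrable M (\<lambda>x. (g x)\<^sup>2)"
  shows "integrable M (\<lambda>x. (f x + g x)\<^sup>2)"
  using integrable_mult_of_squares[OF assms] int by (simp add: power2_sum mult.assoc)

lemma integrable_square_sum:
  fixes f :: "'i \<Rightarrow> 'a \<Rightarrow> real"
  assumes "finite I" "\<And>i. i \<in> I \<Longrightarrow> f i \<in> borel_measurable M"
    and "\<And>i. i \<in> I \<Longrightarrow> integrable M (\<lambda>x. (f i x)\<^sup>2)"
  shows "integrable M (\<lambda>x. (\<Sum>i\<in>I. f i x)\<^sup>2)"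
  using assms by (induction I rule: finite_induct) (auto intro!: integrable_square_add)

lemma borel_measurable_Max_image:
  fixes f :: "nat \<Rightarrow> 'a \<Rightarrow> real"
  assumes "\<And>k. k \<le> n \<Longrightarrow> f k \<in> borel_measurable M"
  shows "(\<lambda>x. Max ((\<lambda>k. f k x) ` {..n})) \<in> borel_measurable M"
  by (rule borel_measurable_Max) (use assms in auto)

lemma Max_square_le:
  fixes f :: "nat \<Rightarrow> real"
  shows "(Max (f ` {..n}))\<^sup>2 \<le> (\<Sum>k\<le>n. (f k)\<^sup>2)"
proof -
  have "Max (f ` {..n}) \<in> f ` {..n}" by (rule Max_in) auto
  then obtain k where k: "Max (f ` {..n}) = f k" "k \<in> {..n}" by (rule imageE)
  show ?thesis unfolding k(1) by (rule member_le_sum[OF k(2)]) auto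
qed

lemma integrable_square_Max:
  fixes f :: "nat \<Rightarrow> 'a \<Rightarrow> real"
  assumes "\<And>k. k \<le> n \<Longrightarrow> f k \<in> borel_measurable M"
    and "\<And>k. k \<le> n \<Longrightarrow> integrable M (\<lambda>x. (f k x)\<^sup>2)"
  shows "integrable M (\<lambda>x. (Max ((\<lambda>k. f k x) ` {..n}))\<^sup>2)"
proof (rule Bochner_Integration.integrable_bound)
  show "integrable M (\<lambda>x. \<Sum>k\<le>n. (f k x)\<^sup>2)" using assms by auto
  show "(\<lambda>x. (Max ((\<lambda>k. f k x) ` {..n}))\<^sup>2) \<in> borel_measurable M"
    using borel_measurable_Max_image[OF assms(1)] by simp
  show "AE x in M. norm ((Max ((\<lambda>k. f k x) ` {..n}))\<^sup>2) \<le> norm (\<Sum>k\<le>n. (f k x)\<^sup>2)"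
    using Max_square_le by (auto intro!: AE_I2 simp: sum_nonneg)
qed

context prob_space
begin

text \<open>The martingale difference property without conditional expectations: \<open>g\<close> is
  an arbitrary measurable functional of the first \<open>k\<close> variables, and independence of
  the blocks \<open>{..<k}\<close> and \<open>{k}\<close> factorises the expectation.\<close>

lemma indep_vars_expectation_past_mult:
  fixes X :: "nat \<Rightarrow> 'a \<Rightarrow> real"
  assumes ind: "indep_vars (\<lambda>_. borel) X UNIV"
    and mean: "expectation (X k) = 0"
    and sq: "integrable M (\<lambda>x. (X k x)\<^sup>2)"
    and g: "g \<in> borel_measurable (PiM {..<k} (\<lambda>_. borel))"
    and gsq: "integrable M (\<lambda>x. (g (\<lambda>i\<in>{..<k}. X i x))\<^sup>2)"
  shows "integrable M (\<lambda>x. g (\<lambda>i\<in>{..<k}. X i x) * X k x)"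
    and "expectation (\<lambda>x. g (\<lambda>i\<in>{..<k}. X i x) * X k x) = 0"
proof -
  have X[measurable]: "X i \<in> borel_measurable M" for i
    using ind by (auto simp: indep_vars_def)
  have "(\<lambda>x. \<lambda>i\<in>{..<k}. X i x) \<in> measurable M (PiM {..<k} (\<lambda>_. borel))"
    by measurable
  then have m: "(\<lambda>x. g (\<lambda>i\<in>{..<k}. X i x)) \<in> borel_measurable M"
    using g by (rule measurable_compose)
  then show "integrable M (\<lambda>x. g (\<lambda>i\<in>{..<k}. X i x) * X k x)"
    using sq gsq by (intro integrable_mult_of_squares) auto
  have "indep_var borel (g \<circ> (\<lambda>x. \<lambda>i\<in>{..<k}. X i x)) borel ((\<lambda>f. f k) \<circ> (\<lambda>x. \<lambda>i\<in>{k}. X i x))"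
  proof (rule indep_var_compose[OF indep_var_restrict[OF ind]])
    show "(\<lambda>f. f k) \<in> borel_measurable (PiM {k} (\<lambda>_. borel :: real measure))"
      by (rule measurable_component_singleton) simp
  qed (use g in simp_all)
  then have "indep_var borel (\<lambda>x. g (\<lambda>i\<in>{..<k}. X i x)) borel (X k)"
    by (simp add: comp_def)
  then have "expectation (\<lambda>x. g (\<lambda>i\<in>{..<k}. X i x) * X k x) = expectation (\<lambda>x. g (\<lambda>i\<in>{..<k}. X i x)) * expectation (X k)"
    using square_integrable_imp_integrable[OF m gsq] square_integrable_imp_integrable[OF X sq]
    by (rule indep_var_lebesgue_integral)
  then show "expectation (\<lambda>x. g (\<lambda>i\<in>{..<k}. X i x) * X k x) = 0" using mean by simp
qed

lemma Doob_L2: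
  fixes X :: "nat \<Rightarrow> 'a \<Rightarrow> real"
  assumes ind: "indep_vars (\<lambda>_. borel) X UNIV"
    and mean: "\<And>i. expectation (X i) = 0"
    and sq: "\<And>i. integrable M (\<lambda>x. (X i x)\<^sup>2)"
    and var: "\<And>i. expectation (\<lambda>x. (X i x)\<^sup>2) \<le> v"
  shows "integrable M (\<lambda>x. (Max ((\<lambda>k. \<Sum>i<k. X i x) ` {..n}))\<^sup>2)"
    and "expectation (\<lambda>x. (Max ((\<lambda>k. \<Sum>i<k. X i x) ` {..n}))\<^sup>2) \<le> 4 * (n * v)"
proof -
  define T where "T k x = (\<Sum>i<k. X i x)" for k x
  define U where "U k x = Max ((\<lambda>j. T j x) ` {..k})" for k x
  have X[measurable]: "X i \<in> borel_measurable M" for i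
    using ind by (auto simp: indep_vars_def)
  have T[measurable]: "T k \<in> borel_measurable M" for k unfolding T_def[abs_def] by measurable
  have U[measurable]: "U k \<in> borel_measurable M" for k
    unfolding U_def[abs_def] by (intro borel_measurable_Max_image) simp
  have Tsq: "integrable M (\<lambda>x. (T k x)\<^sup>2)" for k
    unfolding T_def by (intro integrable_square_sum sq) auto
  have Usq: "integrable M (\<lambda>x. (U k x)\<^sup>2)" for k
    unfolding U_def by (intro integrable_square_Max Tsq) auto
  have Tr: "T k x = (\<lambda>f. \<Sum>i<k. f i) (\<lambda>i\<in>{..<k}. X i x)" for k x
    by (simp add: T_def)
  have Ur: "U k x = (\<lambda>f. Max ((\<lambda>j. \<Sum>i<j. f i) ` {..k})) (\<lambda>i\<in>{..<k}. X i x)" for k x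
    unfolding U_def T_def by (intro arg_cong[where f=Max] image_cong sum.cong) auto
  have TX: "integrable M (\<lambda>x. T k x * X k x)" "expectation (\<lambda>x. T k x * X k x) = 0" for k
    using indep_vars_expectation_past_mult[OF ind mean sq, of "\<lambda>f. \<Sum>i<k. f i" k] Tsq[of k]
    unfolding Tr by auto
  have Um: "(\<lambda>f. Max ((\<lambda>j. \<Sum>i<j. f i) ` {..k})) \<in> borel_measurable (PiM {..<k} (\<lambda>_. borel :: real measure))" for k :: nat
    by (rule borel_measurable_Max_image[where f = "\<lambda>j f. \<Sum>i<j. f i"]) auto
  have UX: "integrable M (\<lambda>x. U k x * X k x)" "expectation (\<lambda>x. U k x * X k x) = 0" for k
    unfolding Ur
    by (rule indep_vars_expectation_past_mult[OF ind mean sq Um Usq[of k, unfolded Ur]])+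
  have ET: "expectation (\<lambda>x. (T k x)\<^sup>2) \<le> k * v" for k
  proof (induction k)
    case (Suc k)
    have "expectation (\<lambda>x. (T (Suc k) x)\<^sup>2) = expectation (\<lambda>x. (T k x)\<^sup>2 + (X k x)\<^sup>2 + 2 * (T k x * X k x))"
      by (simp add: T_def power2_sum mult.assoc)
    also have "\<dots> = expectation (\<lambda>x. (T k x)\<^sup>2) + expectation (\<lambda>x. (X k x)\<^sup>2)"
      using TX Tsq sq by simp
    finally show ?case using Suc var[of k] by (simp add: algebra_simps)
  qed (simp add: T_def)
  have path: "(U n x)\<^sup>2 \<le> 4 * (T n x)\<^sup>2 - 4 * (\<Sum>k<n. U k x * X k x)" for x
  proof -
    have "(U n x)\<^sup>2 / 2 + (\<Sum>k<n. U k x * X k x) \<le> U n x * T n x"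
      using Doob_pathwise[of "\<lambda>k. T k x" n] by (simp add: U_def T_def)
    \<comment> \<open>The square gives \<open>U T \<le> U\<^sup>2 / 4 + T\<^sup>2\<close>; absorbing
      the first term on the left is the origin of the factor 4.\<close>
    moreover have "0 \<le> (U n x / 2 - T n x)\<^sup>2" by simp
    ultimately show ?thesis by (simp add: power2_diff power_divide) 
  qed
  have "expectation (\<lambda>x. (U n x)\<^sup>2) \<le> expectation (\<lambda>x. 4 * (T n x)\<^sup>2 - 4 * (\<Sum>k<n. U k x * X k x))"
    using Usq Tsq UX path by (intro integral_mono) auto
  also have "\<dots> = 4 * expectation (\<lambda>x. (T n x)\<^sup>2)"
    using Tsq UX by simp
  finally show "expectation (\<lambda>x. (Max ((\<lambda>k. \<Sum>i<k. X i x) ` {..n}))\<^sup>2) \<le> 4 * (n * v)"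
    using ET[of n] unfolding U_def T_def by linarith
  show "integrable M (\<lambda>x. (Max ((\<lambda>k. \<Sum>i<k. X i x) ` {..n}))\<^sup>2)"
    using Usq[of n] unfolding U_def T_def .
qed

text \<open>Hoeffding's exponent has \<open>(y + d * k)\<^sup>2\<close> over a multiple of
  \<open>k\<close>. Since this square is at least \<open>4 * y * d * k\<close>, the length
  \<open>k\<close> cancels, and the bound is uniform in \<open>k\<close>.\<close>

lemma prob_bounded_walk_drift:
  fixes X :: "nat \<Rightarrow> 'a \<Rightarrow> real"
  assumes ind: "indep_vars (\<lambda>_. borel) X UNIV"
    and mean: "\<And>i. expectation (X i) = 0"
    and bd: "\<And>i x. \<bar>X i x\<bar> \<le> B" and B: "B > 0" and d: "d \<ge> 0" and y: "y \<ge> 0" and k: "k > 0"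
  shows "prob {x \<in> space M. (\<Sum>i<k. X i x) \<ge> y + d * k} \<le> exp (- 2 * y * d / B\<^sup>2)"
proof -
  interpret Hoeffding_ineq M "{..<k}" X "\<lambda>_. - B" "\<lambda>_. B" 0
  proof unfold_locales
    show "indep_vars (\<lambda>_. borel) X {..<k}" by (rule indep_vars_subset[OF ind]) simp
    show "AE x in M. X i x \<in> {- B..B}" for i
      using bd[of i] by (auto simp: abs_le_iff intro!: AE_I2) (metis minus_le_iff)
  qed (auto simp: mean)
  have "prob {x \<in> space M. (\<Sum>i<k. X i x) \<ge> 0 + (y + d * k)} \<le> exp (- 2 * (y + d * k)\<^sup>2 / (\<Sum>i<k. (B - - B)\<^sup>2))"
    by (rule Hoeffding_ineq_ge) (use B d y k in auto)
  also have "\<dots> \<le> exp (- 2 * y * d / B\<^sup>2)"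
  proof -
    have "0 \<le> (y - d * k)\<^sup>2" by simp
    then have "4 * (y * (d * k)) \<le> (y + d * k)\<^sup>2"
      unfolding power2_sum power2_diff by linarith
    moreover have "2 * y * d / b \<le> 2 * q / (4 * c * b)"
      if "4 * (y * (d * c)) \<le> q" "b > 0" "c > 0" for b c q
    proof -
      have "2 * y * d / b * (4 * c * b) = 2 * (4 * (y * (d * c)))" using that by (simp add: field_simps)
      then show ?thesis using that by (simp add: pos_le_divide_eq)
    qed
    ultimately have "2 * y * d / B\<^sup>2 \<le> 2 * (y + d * k)\<^sup>2 / (4 * k * B\<^sup>2)"
      using B k by simp
    moreover have "(\<Sum>i<k. (B - - B)\<^sup>2) = 4 * k * B\<^sup>2"
      by (simp add: power2_eq_square)
    ultimately show ?thesis by simp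
  qed
  finally show ?thesis by simp
qed

text \<open>Either the maximum is at most \<open>y\<close>, or some event \<open>A k\<close> occurs
  and the trivial bound \<open>n * B\<close> applies. A union bound over the \<open>n\<close>
  events, each controlled uniformly in \<open>k\<close>, yields the factor
  \<open>n ^ 3 * B\<^sup>2\<close>.\<close>

lemma expectation_max_bounded_walk_drift:
  fixes X :: "nat \<Rightarrow> 'a \<Rightarrow> real"
  assumes ind: "indep_vars (\<lambda>_. borel) X UNIV"
    and mean: "\<And>i. expectation (X i) = 0"
    and bd: "\<And>i x. \<bar>X i x\<bar> \<le> B" and B: "B > 0" and d: "d \<ge> 0" and y: "y \<ge> 0"
  shows "integrable M (\<lambda>x. (Max ((\<lambda>k. (\<Sum>i<k. X i x) - d * k) ` {..n}))\<^sup>2)"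
    and "expectation (\<lambda>x. (Max ((\<lambda>k. (\<Sum>i<k. X i x) - d * k) ` {..n}))\<^sup>2)
      \<le> y\<^sup>2 + real n ^ 3 * B\<^sup>2 * exp (- 2 * y * d / B\<^sup>2)"
proof -
  define T where "T k x = (\<Sum>i<k. X i x)" for k x
  define V where "V x = Max ((\<lambda>k. T k x - d * k) ` {..n})" for x
  define A where "A k = {x \<in> space M. T k x \<ge> y + d * k}" for k :: nat
  have X[measurable]: "X i \<in> borel_measurable M" for i
    using ind by (auto simp: indep_vars_def)
  have T[measurable]: "T k \<in> borel_measurable M" for k unfolding T_def[abs_def] by measurable
  have V[measurable]: "V \<in> borel_measurable M"
    unfolding V_def[abs_def] by (intro borel_measurable_Max_image) simp
  have A[measurable]: "A k \<in> sets M" for k unfolding A_def by measurable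
  have Tn: "T k x \<le> n * B" if "k \<le> n" for k x
  proof -
    have "T k x \<le> (\<Sum>i<k. B)" unfolding T_def by (rule sum_mono) (use bd abs_le_D1 in blast)
    also have "\<dots> \<le> n * B" using that B by simp
    finally show ?thesis .
  qed
  have V0: "0 \<le> V x" for x
    unfolding V_def by (rule Max_ge_iff[THEN iffD2]) (auto simp: T_def intro!: bexI[of _ 0])
  have Vn: "V x \<le> n * B" for x
    unfolding V_def
  proof (rule Max.boundedI, goal_cases)
    case (3 a)
    then obtain k where k: "a = T k x - d * k" "k \<in> {..n}" by (rule imageE)
    have "T k x \<le> n * B" "0 \<le> d * k" using Tn[of k x] d k(2) by auto
    then show ?case unfolding k(1) by linarith
  qed auto
  have path: "(V x)\<^sup>2 \<le> y\<^sup>2 + (n * B)\<^sup>2 * (\<Sum>k\<in>{1..n}. indicator (A k) x)" if x: "x \<in> space M" for x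
  proof (cases "V x \<le> y")
    case True
    then have "(V x)\<^sup>2 \<le> y\<^sup>2" using V0 by (intro power_mono) auto
    moreover have "0 \<le> (n * B)\<^sup>2 * (\<Sum>k\<in>{1..n}. indicator (A k) x)"
      by (intro mult_nonneg_nonneg sum_nonneg) auto
    ultimately show ?thesis by linarith
  next
    case False
    have "V x \<in> (\<lambda>k. T k x - d * k) ` {..n}" unfolding V_def by (rule Max_in) auto
    then obtain k where k: "V x = T k x - d * k" "k \<in> {..n}" by (rule imageE)
    \<comment> \<open>Time 0 contributes the value 0, which cannot exceed \<open>y\<close>; it is
      left out of the union because the tail bound needs \<open>k > 0\<close>.\<close>
    have "k \<noteq> 0" using k False y by (intro notI) (simp add: T_def)
    then have "k \<in> {1..n}" using k by simp
    moreover have "indicator (A k) x = (1::real)" using False k x by (simp add: A_def)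
    ultimately have "1 \<le> (\<Sum>k\<in>{1..n}. indicator (A k) x :: real)"
      using member_le_sum[of k "{1..n}" "\<lambda>k. indicator (A k) x :: real"] by simp
    then have "(n * B)\<^sup>2 * 1 \<le> (n * B)\<^sup>2 * (\<Sum>k\<in>{1..n}. indicator (A k) x)"
      by (intro mult_left_mono) auto
    moreover have "(V x)\<^sup>2 \<le> (n * B)\<^sup>2" using V0 Vn by (intro power_mono) auto
    ultimately show ?thesis using zero_le_power2[of y] by linarith
  qed
  have int: "integrable M (\<lambda>x. (V x)\<^sup>2)"
  proof (rule integrable_const_bound[where B = "(n * B)\<^sup>2"])
    show "AE x in M. norm ((V x)\<^sup>2) \<le> (n * B)\<^sup>2"
      using V0 Vn by (auto intro!: AE_I2 power_mono)
  qed simp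
  then show "integrable M (\<lambda>x. (Max ((\<lambda>k. (\<Sum>i<k. X i x) - d * k) ` {..n}))\<^sup>2)"
    unfolding V_def T_def .
  have Aint: "integrable M (indicat_real (A k))" for k
    by (intro integrable_real_indicator) (auto simp: less_top[symmetric])
  have "expectation (\<lambda>x. (V x)\<^sup>2) \<le> expectation (\<lambda>x. y\<^sup>2 + (n * B)\<^sup>2 * (\<Sum>k\<in>{1..n}. indicator (A k) x))"
    using int Aint path by (intro integral_mono) auto
  also have "\<dots> = y\<^sup>2 + (n * B)\<^sup>2 * (\<Sum>k\<in>{1..n}. prob (A k))"
    using Aint by (simp add: prob_space)
  also have "(\<Sum>k\<in>{1..n}. prob (A k)) \<le> (\<Sum>k\<in>{1..n}. exp (- 2 * y * d / B\<^sup>2))"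
    unfolding A_def T_def by (intro sum_mono prob_bounded_walk_drift[OF ind mean bd B d y]) auto
  also have "\<dots> = n * exp (- 2 * y * d / B\<^sup>2)" by simp
  finally have "expectation (\<lambda>x. (V x)\<^sup>2) \<le> y\<^sup>2 + (n * B)\<^sup>2 * (n * exp (- 2 * y * d / B\<^sup>2))"
    by (simp add: mult_left_mono)
  also have "\<dots> = y\<^sup>2 + real n ^ 3 * B\<^sup>2 * exp (- 2 * y * d / B\<^sup>2)"
    by (simp add: power2_eq_square power3_eq_cube)
  finally show "expectation (\<lambda>x. (Max ((\<lambda>k. (\<Sum>i<k. X i x) - d * k) ` {..n}))\<^sup>2)
      \<le> y\<^sup>2 + real n ^ 3 * B\<^sup>2 * exp (- 2 * y * d / B\<^sup>2)"
    unfolding V_def T_def .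
qed

text \<open>The maximum is subadditive, so the whole drift can be given to the bounded part
  \<open>X'\<close>, while the rest \<open>X''\<close> is treated by Doob's inequality with no
  drift. Its bound grows like \<open>n * v\<close>, which is harmless once \<open>v\<close> is
  small.\<close>

lemma expectation_max_walk_drift:
  fixes X X' X'' :: "nat \<Rightarrow> 'a \<Rightarrow> real"
  assumes ind': "indep_vars (\<lambda>_. borel) X' UNIV" and ind'': "indep_vars (\<lambda>_. borel) X'' UNIV"
    and mean': "\<And>i. expectation (X' i) = 0" and mean'': "\<And>i. expectation (X'' i) = 0"
    and bd: "\<And>i x. \<bar>X' i x\<bar> \<le> B" and B: "B > 0" and d: "d \<ge> 0" and y: "y \<ge> 0"
    and sq: "\<And>i. integrable M (\<lambda>x. (X'' i x)\<^sup>2)"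
    and var: "\<And>i. expectation (\<lambda>x. (X'' i x)\<^sup>2) \<le> v"
    and X: "\<And>i x. X i x = X' i x + X'' i x"
  shows "integrable M (\<lambda>x. (Max ((\<lambda>k. (\<Sum>i<k. X i x) - d * k) ` {..n}))\<^sup>2)"
    and "expectation (\<lambda>x. (Max ((\<lambda>k. (\<Sum>i<k. X i x) - d * k) ` {..n}))\<^sup>2)
      \<le> 2 * (y\<^sup>2 + real n ^ 3 * B\<^sup>2 * exp (- 2 * y * d / B\<^sup>2)) + 8 * (n * v)"
proof -
  define V where "V x = Max ((\<lambda>k. (\<Sum>i<k. X i x) - d * k) ` {..n})" for x
  define V' where "V' x = Max ((\<lambda>k. (\<Sum>i<k. X' i x) - d * k) ` {..n})" for x
  define V'' where "V'' x = Max ((\<lambda>k. (\<Sum>i<k. X'' i x)) ` {..n})" for x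
  have m[measurable]: "X' i \<in> borel_measurable M" "X'' i \<in> borel_measurable M" for i
    using ind' ind'' by (auto simp: indep_vars_def)
  have [measurable]: "X i \<in> borel_measurable M" for i unfolding X[abs_def] by measurable
  have [measurable]: "V \<in> borel_measurable M"
    unfolding V_def[abs_def] by (intro borel_measurable_Max_image) simp
  note b' = expectation_max_bounded_walk_drift[OF ind' mean' bd B d y, of n, folded V'_def]
  note b'' = Doob_L2[OF ind'' mean'' sq var, of n, folded V''_def]
  have V0: "0 \<le> V x" for x
    unfolding V_def by (rule Max_ge_iff[THEN iffD2]) (auto intro!: bexI[of _ 0])
  have "V x \<le> V' x + V'' x" for x
    unfolding V_def
  proof (rule Max.boundedI, goal_cases)
    case (3 a)
    then obtain k where k: "k \<le> n" "a = (\<Sum>i<k. X i x) - d * k" by auto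
    have "(\<Sum>i<k. X' i x) - d * k \<le> V' x" "(\<Sum>i<k. X'' i x) \<le> V'' x"
      unfolding V'_def V''_def using k by (auto intro!: Max_ge)
    then show ?case unfolding k X by (simp add: sum.distrib)
  qed auto
  then have le: "(V x)\<^sup>2 \<le> 2 * (V' x)\<^sup>2 + 2 * (V'' x)\<^sup>2" for x
  proof -
    have "(V x)\<^sup>2 \<le> (V' x + V'' x)\<^sup>2" using V0 \<open>V x \<le> V' x + V'' x\<close> by (intro power_mono) auto
    also have "\<dots> \<le> 2 * (V' x)\<^sup>2 + 2 * (V'' x)\<^sup>2"
      using zero_le_power2[of "V' x - V'' x"] by (simp add: power2_sum power2_diff)
    finally show ?thesis .
  qed
  have int: "integrable M (\<lambda>x. (V x)\<^sup>2)"
  proof (rule Bochner_Integration.integrable_bound)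
    show "integrable M (\<lambda>x. 2 * (V' x)\<^sup>2 + 2 * (V'' x)\<^sup>2)" using b' b'' by simp
    show "AE x in M. norm ((V x)\<^sup>2) \<le> norm (2 * (V' x)\<^sup>2 + 2 * (V'' x)\<^sup>2)"
      using le by (auto intro!: AE_I2)
  qed simp
  then show "integrable M (\<lambda>x. (Max ((\<lambda>k. (\<Sum>i<k. X i x) - d * k) ` {..n}))\<^sup>2)"
    unfolding V_def .
  have "expectation (\<lambda>x. (V x)\<^sup>2) \<le> expectation (\<lambda>x. 2 * (V' x)\<^sup>2 + 2 * (V'' x)\<^sup>2)"
    using int b' b'' le by (intro integral_mono) auto
  also have "\<dots> = 2 * expectation (\<lambda>x. (V' x)\<^sup>2) + 2 * expectation (\<lambda>x. (V'' x)\<^sup>2)"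
    using b' b'' by simp
  also have "\<dots> \<le> 2 * (y\<^sup>2 + real n ^ 3 * B\<^sup>2 * exp (- 2 * y * d / B\<^sup>2)) + 2 * (4 * (n * v))"
    by (intro add_mono mult_left_mono b'(2) b''(2)) auto
  finally show "expectation (\<lambda>x. (Max ((\<lambda>k. (\<Sum>i<k. X i x) - d * k) ` {..n}))\<^sup>2)
      \<le> 2 * (y\<^sup>2 + real n ^ 3 * B\<^sup>2 * exp (- 2 * y * d / B\<^sup>2)) + 8 * (n * v)"
    unfolding V_def by simp
qed

section \<open>Reindexing of independent families, and perturbation of limits in mean square\<close>

text \<open>Serves the time-reversed walk. Events chosen for the new indices are moved to the image
  of \<open>J\<close> by the inverse of \<sigma>; injectivity makes this consistent and keeps the
  products equal.\<close>

lemma indep_vars_inj_reindex: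
  assumes ind: "indep_vars N X UNIV" and inj: "inj \<sigma>"
  shows "indep_vars (\<lambda>i. N (\<sigma> i)) (\<lambda>i. X (\<sigma> i)) UNIV"
  unfolding indep_vars_def2
proof (intro conjI ballI)
  show "random_variable (N (\<sigma> i)) (X (\<sigma> i))" for i
    using ind by (simp add: indep_vars_def2)
  let ?F = "\<lambda>i. {X i -` A \<inter> space M |A. A \<in> sets (N i)}"
  have F: "indep_sets ?F UNIV" using ind by (simp add: indep_vars_def2)
  show "indep_sets (\<lambda>i. ?F (\<sigma> i)) UNIV"
  proof (rule indep_setsI)
    show "?F (\<sigma> i) \<subseteq> events" for i using F by (auto simp: indep_sets_def)
    fix A J assume J: "J \<noteq> {}" "J \<subseteq> UNIV" "finite J" and A: "\<forall>j\<in>J. A j \<in> ?F (\<sigma> j)"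
    have "prob (\<Inter>i\<in>\<sigma> ` J. A (the_inv \<sigma> i)) = (\<Prod>i\<in>\<sigma> ` J. prob (A (the_inv \<sigma> i)))"
    proof (rule indep_setsD[OF F])
      show "\<forall>k\<in>\<sigma> ` J. A (the_inv \<sigma> k) \<in> ?F k"
      proof
        fix k assume "k \<in> \<sigma> ` J"
        then obtain j where j: "k = \<sigma> j" "j \<in> J" by (rule imageE)
        show "A (the_inv \<sigma> k) \<in> ?F k"
          unfolding j(1) the_inv_f_f[OF inj] by (rule A[rule_format, OF j(2)])
      qed
    qed (use J in simp_all)
    moreover have "inj_on \<sigma> J" using inj by (rule inj_on_subset) simp
    ultimately show "prob (\<Inter>j\<in>J. A j) = (\<Prod>j\<in>J. prob (A j))"
      unfolding image_image the_inv_f_f[OF inj] by (simp add: prod.reindex the_inv_f_f[OF inj])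
  qed
qed

text \<open>If \<open>A n\<close> and \<open>B n\<close> differ by less than \<open>h\<close>, the
  event for \<open>B n\<close> at \<open>x\<close> is sandwiched between those for
  \<open>A n\<close> at \<open>x - h\<close> and \<open>x + h\<close>. Chebyshev's inequality pays
  for the exception, and continuity of \<open>F\<close> at \<open>x\<close> fixes \<open>h\<close>
  before \<open>n\<close> grows.\<close>

lemma Slutsky_L2:
  fixes A B :: "nat \<Rightarrow> 'a \<Rightarrow> real" and F :: "real \<Rightarrow> real"
  assumes A[measurable]: "\<And>n. A n \<in> borel_measurable M" and B[measurable]: "\<And>n. B n \<in> borel_measurable M"
    and lim: "\<And>x. (\<lambda>n. prob {\<omega> \<in> space M. A n \<omega> \<le> x}) \<longlonglongrightarrow> F x"
    and cont: "isCont F x"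
    and int: "\<And>n. integrable M (\<lambda>\<omega>. (B n \<omega> - A n \<omega>)\<^sup>2)"
    and err: "(\<lambda>n. expectation (\<lambda>\<omega>. (B n \<omega> - A n \<omega>)\<^sup>2)) \<longlonglongrightarrow> 0"
  shows "(\<lambda>n. prob {\<omega> \<in> space M. B n \<omega> \<le> x}) \<longlonglongrightarrow> F x"
proof (rule LIMSEQ_I)
  fix r :: real assume r: "r > 0"
  obtain d where d: "d > 0" "\<And>z. dist z x < d \<Longrightarrow> dist (F z) (F x) < r / 4"
    using cont[unfolded continuous_at_eps_delta, rule_format, of "r / 4"] r by auto
  define h where "h = d / 2"
  have h: "h > 0" "dist (F (x + h)) (F x) < r / 4" "dist (F (x - h)) (F x) < r / 4"
    using d by (auto simp: h_def dist_real_def)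
  let ?E = "\<lambda>n. expectation (\<lambda>\<omega>. (B n \<omega> - A n \<omega>)\<^sup>2)"
  have cheb: "prob {\<omega> \<in> space M. \<bar>B n \<omega> - A n \<omega>\<bar> \<ge> h} \<le> ?E n / h\<^sup>2" for n
    by (rule second_moment_method) (use int h in auto)
  have up: "prob {\<omega> \<in> space M. B n \<omega> \<le> x} \<le> prob {\<omega> \<in> space M. A n \<omega> \<le> x + h} + ?E n / h\<^sup>2" for n
  proof -
    have "prob {\<omega> \<in> space M. B n \<omega> \<le> x} \<le>
      prob ({\<omega> \<in> space M. A n \<omega> \<le> x + h} \<union> {\<omega> \<in> space M. \<bar>B n \<omega> - A n \<omega>\<bar> \<ge> h})"
      by (rule finite_measure_mono) auto
    also have "\<dots> \<le> prob {\<omega> \<in> space M. A n \<omega> \<le> x + h} + prob {\<omega> \<in> space M. \<bar>B n \<omega> - A n \<omega>\<bar> \<ge> h}"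
      by (rule measure_Un_le) auto
    finally show ?thesis using cheb[of n] by linarith
  qed
  have lo: "prob {\<omega> \<in> space M. A n \<omega> \<le> x - h} \<le> prob {\<omega> \<in> space M. B n \<omega> \<le> x} + ?E n / h\<^sup>2" for n
  proof -
    have "prob {\<omega> \<in> space M. A n \<omega> \<le> x - h} \<le>
      prob ({\<omega> \<in> space M. B n \<omega> \<le> x} \<union> {\<omega> \<in> space M. \<bar>B n \<omega> - A n \<omega>\<bar> \<ge> h})"
      by (rule finite_measure_mono) auto
    also have "\<dots> \<le> prob {\<omega> \<in> space M. B n \<omega> \<le> x} + prob {\<omega> \<in> space M. \<bar>B n \<omega> - A n \<omega>\<bar> \<ge> h}"
      by (rule measure_Un_le) auto
    finally show ?thesis using cheb[of n] by linarith
  qed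
  have "(\<lambda>n. ?E n / h\<^sup>2) \<longlonglongrightarrow> 0" using tendsto_divide_zero[OF err] by simp
  then have "\<forall>\<^sub>F n in sequentially. ?E n / h\<^sup>2 < r / 4" using r by (intro order_tendstoD) auto
  moreover have "\<forall>\<^sub>F n in sequentially. dist (prob {\<omega> \<in> space M. A n \<omega> \<le> x + h}) (F (x + h)) < r / 4"
    using tendstoD[OF lim, of "r/4" "x + h"] r by simp
  moreover have "\<forall>\<^sub>F n in sequentially. dist (prob {\<omega> \<in> space M. A n \<omega> \<le> x - h}) (F (x - h)) < r / 4"
    using tendstoD[OF lim, of "r/4" "x - h"] r by simp
  ultimately have "\<forall>\<^sub>F n in sequentially. norm (prob {\<omega> \<in> space M. B n \<omega> \<le> x} - F x) < r"
  proof eventually_elim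
    case (elim n)
    have 1: "prob {\<omega> \<in> space M. A n \<omega> \<le> x + h} < F x + r / 4 + r / 4"
      using elim(2) h(2) unfolding dist_real_def by linarith
    have 2: "F x - r / 4 - r / 4 < prob {\<omega> \<in> space M. A n \<omega> \<le> x - h}"
      using elim(3) h(3) unfolding dist_real_def by linarith
    have "prob {\<omega> \<in> space M. B n \<omega> \<le> x} < F x + r" "F x - r < prob {\<omega> \<in> space M. B n \<omega> \<le> x}"
      using up[of n] lo[of n] 1 2 elim(1) r by linarith+
    then show ?case by (simp add: abs_less_iff)
  qed
  then show "\<exists>N. \<forall>n\<ge>N. norm (prob {\<omega> \<in> space M. B n \<omega> \<le> x} - F x) < r"
    by (simp add: eventually_sequentially)
qed

lemma second_moment_perturbation:
  fixes A B :: "nat \<Rightarrow> 'a \<Rightarrow> real"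
  assumes [measurable]: "\<And>n. A n \<in> borel_measurable M" "\<And>n. B n \<in> borel_measurable M"
    and intA: "\<And>n. integrable M (\<lambda>\<omega>. (A n \<omega>)\<^sup>2)"
    and int: "\<And>n. integrable M (\<lambda>\<omega>. (B n \<omega> - A n \<omega>)\<^sup>2)"
    and lim: "(\<lambda>n. expectation (\<lambda>\<omega>. (A n \<omega>)\<^sup>2)) \<longlonglongrightarrow> c"
    and err: "(\<lambda>n. expectation (\<lambda>\<omega>. (B n \<omega> - A n \<omega>)\<^sup>2)) \<longlonglongrightarrow> 0"
  shows "(\<lambda>n. expectation (\<lambda>\<omega>. (B n \<omega>)\<^sup>2)) \<longlonglongrightarrow> c"
proof -
  define a where "a n = expectation (\<lambda>\<omega>. (A n \<omega>)\<^sup>2)" for n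
  define e where "e n = expectation (\<lambda>\<omega>. (B n \<omega> - A n \<omega>)\<^sup>2)" for n
  \<comment> \<open>This is the weight in the bound of the cross term \<open>2 * A * (B - A)\<close>
    by a weighted sum of squares. The optimal order is \<open>sqrt (e n)\<close>; the summand
    \<open>1 / real (Suc n)\<close> keeps the weight positive when \<open>e n = 0\<close>.\<close>
  define t where "t n = sqrt (e n) + 1 / real (Suc n)" for n
  have e0: "e n \<ge> 0" for n unfolding e_def by simp
  have t0: "t n > 0" for n unfolding t_def using e0 by (simp add: add_nonneg_pos)
  have bound: "\<bar>expectation (\<lambda>\<omega>. (B n \<omega>)\<^sup>2) - a n\<bar> \<le> t n * a n + sqrt (e n) + e n" for n
  proof -
    let ?D = "\<lambda>\<omega>. B n \<omega> - A n \<omega>"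
    have prod: "integrable M (\<lambda>\<omega>. A n \<omega> * ?D \<omega>)"
      using intA int by (intro integrable_mult_of_squares) auto
    have "expectation (\<lambda>\<omega>. (B n \<omega>)\<^sup>2) = expectation (\<lambda>\<omega>. (A n \<omega>)\<^sup>2 + 2 * (A n \<omega> * ?D \<omega>) + (?D \<omega>)\<^sup>2)"
      by (intro Bochner_Integration.integral_cong) (auto simp: power2_eq_square algebra_simps)
    also have "\<dots> = a n + 2 * expectation (\<lambda>\<omega>. A n \<omega> * ?D \<omega>) + e n"
      unfolding a_def e_def using intA int prod by simp
    finally have 1: "expectation (\<lambda>\<omega>. (B n \<omega>)\<^sup>2) = a n + 2 * expectation (\<lambda>\<omega>. A n \<omega> * ?D \<omega>) + e n" .
    have "2 * \<bar>expectation (\<lambda>\<omega>. A n \<omega> * ?D \<omega>)\<bar> \<le> 2 * expectation (\<lambda>\<omega>. \<bar>A n \<omega> * ?D \<omega>\<bar>)"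
      by (simp add: integral_abs_bound)
    also have "\<dots> = expectation (\<lambda>\<omega>. 2 * \<bar>A n \<omega> * ?D \<omega>\<bar>)" by simp
    also have "\<dots> \<le> expectation (\<lambda>\<omega>. t n * (A n \<omega>)\<^sup>2 + (?D \<omega>)\<^sup>2 / t n)"
    proof (rule integral_mono)
      fix \<omega>
      have "0 \<le> (sqrt (t n) * \<bar>A n \<omega>\<bar> - \<bar>?D \<omega>\<bar> / sqrt (t n))\<^sup>2" by simp
      also have "(sqrt (t n) * p - q / sqrt (t n))\<^sup>2 = t n * p\<^sup>2 + q\<^sup>2 / t n - 2 * (p * q)" for p q
        using t0[of n] by (simp add: power2_diff power_mult_distrib power_divide)
      finally have "0 \<le> t n * \<bar>A n \<omega>\<bar>\<^sup>2 + \<bar>?D \<omega>\<bar>\<^sup>2 / t n - 2 * (\<bar>A n \<omega>\<bar> * \<bar>?D \<omega>\<bar>)" .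
      then show "2 * \<bar>A n \<omega> * ?D \<omega>\<bar> \<le> t n * (A n \<omega>)\<^sup>2 + (?D \<omega>)\<^sup>2 / t n"
        unfolding abs_mult power2_abs by linarith
    qed (use intA int prod in auto)
    also have "\<dots> = t n * a n + e n / t n" unfolding a_def e_def using intA int by simp
    also have "e n / t n \<le> sqrt (e n)"
    proof -
      have "sqrt (e n) * sqrt (e n) \<le> sqrt (e n) * t n"
        by (intro mult_left_mono) (simp_all add: t_def e0)
      then show ?thesis using t0[of n] e0[of n] by (simp only: pos_divide_le_eq real_sqrt_mult_self abs_of_nonneg)
    qed
    finally show ?thesis using 1 e0[of n] by linarith
  qed
  have e: "e \<longlonglongrightarrow> 0" using err unfolding e_def .
  have se: "(\<lambda>n. sqrt (e n)) \<longlonglongrightarrow> 0" using tendsto_real_sqrt[OF e] by simp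
  have t: "t \<longlonglongrightarrow> 0" unfolding t_def[abs_def]
    using tendsto_add[OF se LIMSEQ_inverse_real_of_nat] by (simp add: inverse_eq_divide)
  have a: "a \<longlonglongrightarrow> c" using lim unfolding a_def .
  have "(\<lambda>n. t n * a n + sqrt (e n) + e n) \<longlonglongrightarrow> 0 * c + 0 + 0"
    by (rule tendsto_add[OF tendsto_add[OF tendsto_mult[OF t a] se] e])
  then have "(\<lambda>n. t n * a n + sqrt (e n) + e n) \<longlonglongrightarrow> 0" by simp
  then have "(\<lambda>n. expectation (\<lambda>\<omega>. (B n \<omega>)\<^sup>2) - a n) \<longlonglongrightarrow> 0"
    by (rule Lim_null_comparison[rotated]) (intro always_eventually allI, unfold real_norm_def, rule bound)
  from tendsto_add[OF this a] show ?thesis by simp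
qed

end

lemma isCont_cdf_std_normal: "isCont (cdf std_normal_distribution) x"
proof -
  interpret real_distribution std_normal_distribution by (rule real_dist_normal_dist)
  have "emeasure std_normal_distribution {x} = 0"
    by (simp add: emeasure_density)
  then have "measure std_normal_distribution {x} = 0" by (simp add: measure_def)
  then show ?thesis by (simp add: isCont_cdf)
qed

subsection \<open>Planar random walks with drift\<close>

definition trunc :: "real \<Rightarrow> real^2 \<Rightarrow> real^2" where
  "trunc K z = (if norm z \<le> K then z else 0)"

lemma norm_trunc_le: "K \<ge> 0 \<Longrightarrow> norm (trunc K z) \<le> K"
  by (simp add: trunc_def)

lemma measurable_trunc [measurable]: "trunc K \<in> borel_measurable borel"
  unfolding trunc_def[abs_def] by measurable

text \<open>Time reversal of the first \<open>n\<close> increments, continued by the identity so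
  that it is injective on all indices and preserves independence of the whole sequence.\<close>

definition reflect :: "nat \<Rightarrow> nat \<Rightarrow> nat" where
  "reflect n i = (if i < n then n - 1 - i else i)"

lemma inj_reflect: "inj (reflect n)"
  by (auto simp: inj_def reflect_def split: if_splits)

lemma sum_reflect:
  fixes f :: "nat \<Rightarrow> 'b::ab_group_add"
  assumes "k \<le> n"
  shows "(\<Sum>i<n - k. f (reflect n i)) = (\<Sum>i<n. f i) - (\<Sum>i<k. f i)"
proof -
  have "(\<Sum>i<n - k. f (reflect n i)) = (\<Sum>i\<in>{k..<n}. f i)"
    by (rule sum.reindex_bij_witness[of _ "\<lambda>i. n - 1 - i" "\<lambda>i. n - 1 - i"])
      (use assms in \<open>auto simp: reflect_def\<close>)
  moreover have "(\<Sum>i<n. f i) = (\<Sum>i<k. f i) + (\<Sum>i\<in>{k..<n}. f i)"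
    using sum.atLeastLessThan_concat[of 0 k n f] assms by (simp add: lessThan_atLeast0)
  ultimately show ?thesis by simp
qed

locale planar_walk = prob_space M for M :: "'a measure" +
  fixes Z :: "nat \<Rightarrow> 'a \<Rightarrow> real^2"
  assumes indep: "indep_vars (\<lambda>_. borel) Z UNIV"
    and ident: "\<And>i. distr M borel (Z i) = distr M borel (Z 0)"
    and sq_int: "integrable M (\<lambda>\<omega>. (norm (Z 0 \<omega>))\<^sup>2)"
begin

definition mu :: "real^2" where "mu = expectation (Z 0)"

definition walk :: "nat \<Rightarrow> 'a \<Rightarrow> real^2" where "walk n \<omega> = (\<Sum>i<n. Z i \<omega>)"

definition perimeter :: "nat \<Rightarrow> 'a \<Rightarrow> real" where
  "perimeter n \<omega> = hull_perimeter ((\<lambda>k. walk k \<omega>) ` {..n})"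

lemma Z_measurable [measurable]: "Z i \<in> borel_measurable M"
  using indep by (auto simp: indep_vars_def)

lemma walk_measurable [measurable]: "walk n \<in> borel_measurable M"
  unfolding walk_def[abs_def] by measurable

lemma perimeter_measurable [measurable]: "perimeter n \<in> borel_measurable M"
  unfolding perimeter_def[abs_def] by (rule measurable_hull_perimeter) measurable

lemma integral_Z:
  fixes f :: "real^2 \<Rightarrow> 'b::{banach, second_countable_topology}"
  assumes [measurable]: "f \<in> borel_measurable borel"
  shows "expectation (\<lambda>x. f (Z i x)) = expectation (\<lambda>x. f (Z 0 x))"
    and "integrable M (\<lambda>x. f (Z i x)) \<longleftrightarrow> integrable M (\<lambda>x. f (Z 0 x))"
proof -
  show "expectation (\<lambda>x. f (Z i x)) = expectation (\<lambda>x. f (Z 0 x))"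
    using integral_distr[of "Z i" M borel f] integral_distr[of "Z 0" M borel f] ident[of i] by simp
  show "integrable M (\<lambda>x. f (Z i x)) \<longleftrightarrow> integrable M (\<lambda>x. f (Z 0 x))"
    using integrable_distr_eq[of "Z i" M borel f] integrable_distr_eq[of "Z 0" M borel f] ident[of i] by simp
qed

lemma integrable_norm_Z_sq: "integrable M (\<lambda>x. (norm (Z i x))\<^sup>2)"
  using integral_Z(2)[of "\<lambda>z. (norm z)\<^sup>2" i] sq_int by simp

lemma integrable_Z: "integrable M (Z i)"
proof -
  have "integrable M (\<lambda>x. norm (Z i x))"
    by (rule square_integrable_imp_integrable) (use integrable_norm_Z_sq in auto)
  then show ?thesis by (simp add: integrable_norm_iff)
qed

lemma expectation_Z: "expectation (Z i) = mu"
  using integral_Z(1)[of "\<lambda>z. z" i] by (simp add: mu_def)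

lemma integrable_square_of_norm_le:
  fixes g :: "real^2 \<Rightarrow> real"
  assumes [measurable]: "g \<in> borel_measurable borel" and g: "\<And>z. \<bar>g z\<bar> \<le> C * norm z"
  shows "integrable M (\<lambda>x. (g (Z i x))\<^sup>2)"
proof (rule Bochner_Integration.integrable_bound)
  show "integrable M (\<lambda>x. C\<^sup>2 * (norm (Z i x))\<^sup>2)" using integrable_norm_Z_sq by simp
  show "AE x in M. norm ((g (Z i x))\<^sup>2) \<le> norm (C\<^sup>2 * (norm (Z i x))\<^sup>2)"
  proof (rule AE_I2)
    fix x
    have "\<bar>g (Z i x)\<bar>\<^sup>2 \<le> (C * norm (Z i x))\<^sup>2" using g by (intro power_mono) auto
    then show "norm ((g (Z i x))\<^sup>2) \<le> norm (C\<^sup>2 * (norm (Z i x))\<^sup>2)"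
      by (simp add: power_mult_distrib)
  qed
qed measurable

section \<open>Truncation and excursions against the drift\<close>

definition tail_var :: "real \<Rightarrow> real" where
  "tail_var K = expectation (\<lambda>x. (norm (Z 0 x - trunc K (Z 0 x)))\<^sup>2)"

text \<open>Each single vector is eventually left unchanged by truncation, and the square of its
  norm dominates. No rate results from a finite second moment alone, so the truncation level will be
  fixed before \<open>n\<close> tends to infinity.\<close>

lemma tail_var_tendsto_0: "(\<lambda>k. tail_var (real k)) \<longlonglongrightarrow> 0"
proof -
  have "(\<lambda>k. expectation (\<lambda>x. (norm (Z 0 x - trunc (real k) (Z 0 x)))\<^sup>2)) \<longlonglongrightarrow> expectation (\<lambda>x. 0)"
  proof (rule integral_dominated_convergence[where w = "\<lambda>x. (norm (Z 0 x))\<^sup>2"])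
    show "integrable M (\<lambda>x. (norm (Z 0 x))\<^sup>2)" by (rule sq_int)
    show "AE x in M. (\<lambda>k. (norm (Z 0 x - trunc (real k) (Z 0 x)))\<^sup>2) \<longlonglongrightarrow> 0"
    proof (rule AE_I2, rule tendsto_eventually)
      fix x
      obtain k0 :: nat where k0: "norm (Z 0 x) \<le> real k0" using real_arch_simple by blast
      show "\<forall>\<^sub>F k in sequentially. (norm (Z 0 x - trunc (real k) (Z 0 x)))\<^sup>2 = 0"
        unfolding eventually_sequentially using k0 by (intro exI[of _ k0]) (auto simp: trunc_def)
    qed
    show "AE x in M. norm ((norm (Z 0 x - trunc (real k) (Z 0 x)))\<^sup>2) \<le> (norm (Z 0 x))\<^sup>2" for k
      by (auto intro!: AE_I2 simp: trunc_def)
  qed measurable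
  then show ?thesis by (simp add: tail_var_def)
qed

text \<open>For \<open>d \<le> mu \<bullet> e\<close> this dominates the deepest descent of the
  reindexed walk below its start in direction \<open>e\<close>. Centred increments with a separate
  drift \<open>d\<close> match the maximal inequalities and allow \<open>d\<close> to be smaller
  than the true drift.\<close>

definition drift_max :: "real^2 \<Rightarrow> real \<Rightarrow> (nat \<Rightarrow> nat) \<Rightarrow> nat \<Rightarrow> 'a \<Rightarrow> real" where
  "drift_max e d \<sigma> n x = Max ((\<lambda>k. (\<Sum>i<k. - ((Z (\<sigma> i) x - mu) \<bullet> e)) - d * k) ` {..n})"

text \<open>For \<open>norm e \<le> 2\<close> a truncated increment projects to at most
  \<open>2 * K\<close> in absolute value, and to at most \<open>4 * K\<close> after centring; the
  same bound on \<open>e\<close> multiplies the tail variance by 4.\<close>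

definition drift_bound :: "nat \<Rightarrow> real \<Rightarrow> real \<Rightarrow> real \<Rightarrow> real" where
  "drift_bound n d y K = 2 * (y\<^sup>2 + real n ^ 3 * (4 * K)\<^sup>2 * exp (- 2 * y * d / (4 * K)\<^sup>2))
    + 8 * (n * (4 * tail_var K))"

lemma drift_max_measurable [measurable]: "drift_max e d \<sigma> n \<in> borel_measurable M"
  unfolding drift_max_def[abs_def] by (intro borel_measurable_Max_image) simp

text \<open>The vectors are truncated before projection, and both parts are then centred separately.
  Their means add up to \<open>- (mu \<bullet> e)\<close>, so the centred parts still add up to the
  centred increment.\<close>

lemma drift_max_second_moment:
  assumes \<sigma>: "inj \<sigma>" and e: "norm e \<le> 2" and d: "d \<ge> 0" and y: "y \<ge> 0" and K: "K > 0"
  shows "integrable M (\<lambda>x. (drift_max e d \<sigma> n x)\<^sup>2)"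
    and "expectation (\<lambda>x. (drift_max e d \<sigma> n x)\<^sup>2) \<le> drift_bound n d y K"
proof -
  define g where "g z = - (trunc K z \<bullet> e)" for z
  define h where "h z = - ((z - trunc K z) \<bullet> e)" for z
  define X' where "X' i x = g (Z (\<sigma> i) x) - expectation (\<lambda>x. g (Z 0 x))" for i x
  define X'' where "X'' i x = h (Z (\<sigma> i) x) - expectation (\<lambda>x. h (Z 0 x))" for i x
  have [measurable]: "g \<in> borel_measurable borel" "h \<in> borel_measurable borel"
    unfolding g_def[abs_def] h_def[abs_def] by measurable
  have indep\<sigma>: "indep_vars (\<lambda>_. borel) (\<lambda>i. Z (\<sigma> i)) UNIV"
    using indep_vars_inj_reindex[OF indep \<sigma>] .
  have g_le: "\<bar>g z\<bar> \<le> 2 * K" for z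
  proof -
    have "\<bar>g z\<bar> \<le> norm (trunc K z) * norm e" unfolding g_def by (simp add: Cauchy_Schwarz_ineq2)
    also have "\<dots> \<le> K * 2" using norm_trunc_le[of K z] e K by (intro mult_mono) auto
    finally show ?thesis by simp
  qed
  have h_le: "\<bar>h z\<bar> \<le> 2 * norm (z - trunc K z)" for z
  proof -
    have "\<bar>h z\<bar> \<le> norm (z - trunc K z) * norm e"
      unfolding h_def abs_minus_cancel by (rule Cauchy_Schwarz_ineq2)
    also have "\<dots> \<le> norm (z - trunc K z) * 2" using e by (intro mult_left_mono) auto
    finally show ?thesis by simp
  qed
  have int_g: "integrable M (\<lambda>x. g (Z i x))" for i
    by (rule integrable_const_bound[where B = "2 * K"]) (use g_le in auto)
  have "norm (z - trunc K z) \<le> norm z" for z by (simp add: trunc_def)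
  then have h_le': "\<bar>h z\<bar> \<le> 2 * norm z" for z using h_le[of z] by (meson mult_left_mono order_trans zero_le_numeral)
  have int_h2: "integrable M (\<lambda>x. (h (Z i x))\<^sup>2)" for i
    by (rule integrable_square_of_norm_le[where C = 2]) (use h_le' in auto)
  have int_h: "integrable M (\<lambda>x. h (Z i x))" for i
    by (rule square_integrable_imp_integrable[OF _ int_h2]) simp
  have Eg: "expectation (\<lambda>x. g (Z i x)) = expectation (\<lambda>x. g (Z 0 x))" for i by (rule integral_Z) simp
  have Eh: "expectation (\<lambda>x. h (Z i x)) = expectation (\<lambda>x. h (Z 0 x))" for i by (rule integral_Z) simp
  have ind': "indep_vars (\<lambda>_. borel) X' UNIV"
    unfolding X'_def[abs_def] by (rule indep_vars_compose2[OF indep\<sigma>]) simp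
  have ind'': "indep_vars (\<lambda>_. borel) X'' UNIV"
    unfolding X''_def[abs_def] by (rule indep_vars_compose2[OF indep\<sigma>]) simp
  have mean': "expectation (X' i) = 0" for i
    unfolding X'_def using int_g Eg by (simp add: prob_space)
  have mean'': "expectation (X'' i) = 0" for i
    unfolding X''_def using int_h Eh by (simp add: prob_space)
  have bd: "\<bar>X' i x\<bar> \<le> 4 * K" for i x
  proof -
    have "\<bar>expectation (\<lambda>x. g (Z 0 x))\<bar> \<le> expectation (\<lambda>x. \<bar>g (Z 0 x)\<bar>)" by (rule integral_abs_bound)
    also have "\<dots> \<le> 2 * K" by (rule integral_le_const) (use int_g g_le in auto)
    finally show ?thesis using g_le[of "Z (\<sigma> i) x"] unfolding X'_def by linarith
  qed
  have sq: "integrable M (\<lambda>x. (X'' i x)\<^sup>2)" for i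
    unfolding X''_def power2_diff using int_h int_h2 by simp
  have var: "expectation (\<lambda>x. (X'' i x)\<^sup>2) \<le> 4 * tail_var K" for i
  proof -
    have "expectation (\<lambda>x. (X'' i x)\<^sup>2) = variance (\<lambda>x. h (Z (\<sigma> i) x))"
      unfolding X''_def Eh[of "\<sigma> i"] ..
    also have "\<dots> \<le> expectation (\<lambda>x. (h (Z (\<sigma> i) x))\<^sup>2)"
      using int_h int_h2 by (simp add: variance_eq)
    also have "\<dots> = expectation (\<lambda>x. (h (Z 0 x))\<^sup>2)"
      by (rule integral_Z(1)[of "\<lambda>z. (h z)\<^sup>2"]) simp
    also have "\<dots> \<le> expectation (\<lambda>x. 4 * (norm (Z 0 x - trunc K (Z 0 x)))\<^sup>2)"
    proof (rule integral_mono)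
      have "integrable M (\<lambda>x. (norm (Z 0 x - trunc K (Z 0 x)))\<^sup>2)"
        by (rule integrable_square_of_norm_le[where C = 1]) (auto simp: trunc_def)
      then show "integrable M (\<lambda>x. 4 * (norm (Z 0 x - trunc K (Z 0 x)))\<^sup>2)" by simp
      show "(h (Z 0 x))\<^sup>2 \<le> 4 * (norm (Z 0 x - trunc K (Z 0 x)))\<^sup>2" for x
        using power_mono[OF h_le[of "Z 0 x"], of 2] by (simp add: power_mult_distrib)
    qed (rule int_h2)
    finally show ?thesis by (simp add: tail_var_def)
  qed
  have split: "- ((Z (\<sigma> i) x - mu) \<bullet> e) = X' i x + X'' i x" for i x
  proof -
    have "expectation (\<lambda>x. g (Z 0 x)) + expectation (\<lambda>x. h (Z 0 x)) = expectation (\<lambda>x. g (Z 0 x) + h (Z 0 x))"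
      using int_g int_h by simp
    also have "(\<lambda>x. g (Z 0 x) + h (Z 0 x)) = (\<lambda>x. - (Z 0 x \<bullet> e))"
      by (simp add: g_def h_def inner_diff_left)
    also have "expectation \<dots> = - (mu \<bullet> e)" using integrable_Z[of 0] by (simp add: mu_def)
    finally show ?thesis by (simp add: X'_def X''_def g_def h_def inner_diff_left)
  qed
  have B: "4 * K > 0" using K by simp
  note main = expectation_max_walk_drift[where X = "\<lambda>i x. - ((Z (\<sigma> i) x - mu) \<bullet> e)", OF ind' ind'' mean' mean'' bd B d y sq var split, of n]
  show "integrable M (\<lambda>x. (drift_max e d \<sigma> n x)\<^sup>2)"
    unfolding drift_max_def by (rule main)
  show "expectation (\<lambda>x. (drift_max e d \<sigma> n x)\<^sup>2) \<le> drift_bound n d y K"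
    unfolding drift_max_def drift_bound_def by (rule main)
qed

lemma drift_max_nonneg: "0 \<le> drift_max e d \<sigma> n x"
  unfolding drift_max_def by (rule Max_ge_iff[THEN iffD2]) (auto intro!: bexI[of _ 0])

lemma drift_max_ge: "k \<le> n \<Longrightarrow> (\<Sum>i<k. - ((Z (\<sigma> i) x - mu) \<bullet> e)) - d * k \<le> drift_max e d \<sigma> n x"
  unfolding drift_max_def by (rule Max_ge) auto

definition width_err :: "real^2 \<Rightarrow> real \<Rightarrow> nat \<Rightarrow> 'a \<Rightarrow> real" where
  "width_err e d n x = drift_max e d (\<lambda>i. i) n x + drift_max e d (reflect n) n x"

lemma width_err_measurable [measurable]: "width_err e d n \<in> borel_measurable M"
  unfolding width_err_def[abs_def] by measurable

lemma width_err_nonneg: "0 \<le> width_err e d n x"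
  unfolding width_err_def using drift_max_nonneg by (simp add: add_nonneg_nonneg)

text \<open>The minimum of the projected walk is controlled by the descent of the walk itself. For
  the maximum, \<open>walk k\<close> is \<open>walk n\<close> minus the time-reversed walk after
  \<open>n - k\<close> steps, so the descent of the reversed walk bounds how far the walk overshoots
  its endpoint.\<close>

lemma width_le:
  assumes d: "d \<le> mu \<bullet> e"
  shows "width e ((\<lambda>k. walk k x) ` {..n}) \<le> walk n x \<bullet> e + width_err e d n x"
proof -
  let ?Q = "(\<lambda>k. walk k x \<bullet> e) ` {..n}"
  have lin: "(\<Sum>i<k. - ((Z (\<sigma> i) x - mu) \<bullet> e)) - d * k \<ge> - ((\<Sum>i<k. Z (\<sigma> i) x) \<bullet> e)" for k :: nat and \<sigma>
  proof -
    have "(\<Sum>i<k. - ((Z (\<sigma> i) x - mu) \<bullet> e)) - d * k = - ((\<Sum>i<k. Z (\<sigma> i) x) \<bullet> e) + k * (mu \<bullet> e - d)"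
      by (simp add: inner_diff_left sum_subtractf sum_negf inner_sum_left algebra_simps)
    moreover have "0 \<le> k * (mu \<bullet> e - d)" using d by simp
    ultimately show ?thesis by linarith
  qed
  have lo: "- (walk k x \<bullet> e) \<le> drift_max e d (\<lambda>i. i) n x" if "k \<le> n" for k
  proof -
    have "- ((\<Sum>i<k. Z i x) \<bullet> e) \<le> drift_max e d (\<lambda>i. i) n x"
      by (rule order_trans[OF lin drift_max_ge[OF that]])
    then show ?thesis by (simp add: walk_def)
  qed
  have hi: "walk k x \<bullet> e \<le> walk n x \<bullet> e + drift_max e d (reflect n) n x" if "k \<le> n" for k
  proof -
    have "- ((\<Sum>i<n - k. Z (reflect n i) x) \<bullet> e) \<le> drift_max e d (reflect n) n x"
      by (rule order_trans[OF lin drift_max_ge]) simp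
    then show ?thesis
      unfolding sum_reflect[OF that, of "\<lambda>i. Z i x"] by (simp add: walk_def inner_diff_left)
  qed
  have "Max ?Q \<le> walk n x \<bullet> e + drift_max e d (reflect n) n x"
    using hi by (intro Max.boundedI) auto
  moreover have "- drift_max e d (\<lambda>i. i) n x \<le> Min ?Q"
    using lo by (intro Min.boundedI) (auto simp: minus_le_iff)
  ultimately show ?thesis unfolding width_def width_err_def image_image by linarith
qed

lemma width_err_second_moment:
  assumes e: "norm e \<le> 2" and d: "d \<ge> 0" and y: "y \<ge> 0" and K: "K > 0"
  shows "integrable M (\<lambda>x. (width_err e d n x)\<^sup>2)"
    and "expectation (\<lambda>x. (width_err e d n x)\<^sup>2) \<le> 4 * drift_bound n d y K"
proof -
  have "inj (\<lambda>i::nat. i)" by simp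
  note 1 = drift_max_second_moment[OF this e d y K, of n]
  note 2 = drift_max_second_moment[OF inj_reflect[of n] e d y K, of n]
  show int: "integrable M (\<lambda>x. (width_err e d n x)\<^sup>2)"
    unfolding width_err_def using 1 2 by (intro integrable_square_add) auto
  have "expectation (\<lambda>x. (width_err e d n x)\<^sup>2)
    \<le> expectation (\<lambda>x. 2 * (drift_max e d (\<lambda>i. i) n x)\<^sup>2 + 2 * (drift_max e d (reflect n) n x)\<^sup>2)"
  proof (rule integral_mono[OF int])
    fix x
    show "(width_err e d n x)\<^sup>2 \<le> 2 * (drift_max e d (\<lambda>i. i) n x)\<^sup>2 + 2 * (drift_max e d (reflect n) n x)\<^sup>2"
      unfolding width_err_def
      using zero_le_power2[of "drift_max e d (\<lambda>i. i) n x - drift_max e d (reflect n) n x"]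
      by (simp add: power2_sum power2_diff)
  qed (use 1 2 in simp)
  also have "\<dots> \<le> 4 * drift_bound n d y K" using 1 2 by simp
  finally show "expectation (\<lambda>x. (width_err e d n x)\<^sup>2) \<le> 4 * drift_bound n d y K" .
qed

section \<open>The excess of the perimeter over twice the drift component\<close>

definition mu_dir :: "real^2" where "mu_dir = mu /\<^sub>R norm mu"

definition excess :: "nat \<Rightarrow> 'a \<Rightarrow> real" where
  "excess n x = perimeter n x - 2 * (walk n x \<bullet> mu_dir)"

lemma excess_measurable [measurable]: "excess n \<in> borel_measurable M"
  unfolding excess_def[abs_def] by measurable

lemma norm_mu_dir: "mu \<noteq> 0 \<Longrightarrow> norm mu_dir = 1"
  by (simp add: mu_dir_def)

lemma mu_inner_mu_dir: "mu \<bullet> mu_dir = norm mu"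
  by (cases "mu = 0") (simp_all add: mu_dir_def dot_square_norm power2_eq_square)

lemma mu_inner_perp: "mu \<bullet> perp mu_dir = 0"
proof -
  have "perp mu_dir = perp mu /\<^sub>R norm mu"
    by (simp add: mu_dir_def perp_def vec_eq_iff forall_2)
  then show ?thesis by (simp add: inner_perp_self)
qed

text \<open>The points include the origin and \<open>walk n\<close>, so the width along the drift is
  at least the component of \<open>walk n\<close>. The sign is what permits squaring the upper bound
  of the excess.\<close>

lemma excess_nonneg:
  assumes "mu \<noteq> 0"
  shows "0 \<le> excess n x"
proof -
  let ?P = "(\<lambda>k. walk k x) ` {..n}"
  have "walk n x \<bullet> mu_dir \<le> Max ((\<lambda>p. p \<bullet> mu_dir) ` ?P)" by (rule Max_ge) auto
  moreover have "Min ((\<lambda>p. p \<bullet> mu_dir) ` ?P) \<le> walk 0 x \<bullet> mu_dir" by (rule Min_le) auto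
  moreover have "walk 0 x \<bullet> mu_dir = 0" by (simp add: walk_def)
  ultimately have "walk n x \<bullet> mu_dir \<le> width mu_dir ?P" unfolding width_def by linarith
  moreover have "2 * width mu_dir ?P \<le> perimeter n x"
    unfolding perimeter_def by (rule perimeter_ge_width) (auto simp: norm_mu_dir[OF assms])
  ultimately show ?thesis by (simp add: excess_def)
qed

definition tilted :: "real \<Rightarrow> real \<Rightarrow> real^2" where
  "tilted c s = s *\<^sub>R mu_dir + c *\<^sub>R perp mu_dir"

text \<open>In the three-width bound the endpoint terms combine to \<open>2 + s\<^sup>2\<close>
  times the drift component, since the transverse parts of the two tilts cancel; subtracting twice
  that component leaves the defect \<open>s\<^sup>2\<close>. The absolute value covers a walk that
  ends behind its start.\<close>

lemma excess_le:
  assumes mu: "mu \<noteq> 0" and s: "0 \<le> s" "s \<le> 1"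
  defines "d \<equiv> s * norm mu"
  shows "excess n x \<le> s\<^sup>2 * \<bar>walk n x \<bullet> mu_dir\<bar> + 3 * width_err mu_dir d n x
    + width_err (tilted 1 s) d n x + width_err (tilted (- 1) s) d n x"
proof -
  let ?P = "(\<lambda>k. walk k x) ` {..n}" and ?S = "walk n x \<bullet> mu_dir"
  define a where "a = 1 + s\<^sup>2 / 2 - s"
  have a3: "2 * a + 2 * s = 2 + s\<^sup>2" by (simp add: a_def)
  have "0 \<le> s\<^sup>2" "s\<^sup>2 \<le> 1" using s by (auto intro: power_le_one)
  then have a: "0 \<le> a" "2 * a \<le> 3" using s a3 by linarith+
  \<comment> \<open>\<open>d\<close> is the exact drift in the tilted directions and, by
    \<open>s \<le> 1\<close>, a lower bound along \<open>mu_dir\<close>, so one parameter serves all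
    three widths.\<close>
  have d: "d \<le> mu \<bullet> mu_dir" "d \<le> mu \<bullet> tilted 1 s" "d \<le> mu \<bullet> tilted (- 1) s"
    using s by (auto simp: d_def mu_inner_mu_dir tilted_def inner_add_right inner_diff_right mu_inner_perp mult_left_le_one_le)
  have "perimeter n x \<le> 2 * a * width mu_dir ?P + width (tilted 1 s) ?P + width (tilted (- 1) s) ?P"
    using perimeter_le_three_widths[of ?P mu_dir s] norm_mu_dir[OF mu] s
    by (simp add: perimeter_def a_def tilted_def)
  also have "\<dots> \<le> 2 * a * (?S + width_err mu_dir d n x) + (walk n x \<bullet> tilted 1 s + width_err (tilted 1 s) d n x)
      + (walk n x \<bullet> tilted (- 1) s + width_err (tilted (- 1) s) d n x)"
    by (intro add_mono mult_left_mono width_le d) (use a in auto)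
  also have "\<dots> = (2 * a + 2 * s) * ?S + 2 * a * width_err mu_dir d n x
      + width_err (tilted 1 s) d n x + width_err (tilted (- 1) s) d n x"
    by (simp add: tilted_def inner_add_right inner_diff_right algebra_simps)
  also have "\<dots> \<le> (2 * ?S + s\<^sup>2 * \<bar>?S\<bar>) + 3 * width_err mu_dir d n x
      + width_err (tilted 1 s) d n x + width_err (tilted (- 1) s) d n x"
  proof (intro add_mono mult_right_mono a(2) width_err_nonneg order_refl)
    have "s\<^sup>2 * ?S \<le> s\<^sup>2 * \<bar>?S\<bar>" by (intro mult_left_mono) auto
    then show "(2 * a + 2 * s) * ?S \<le> 2 * ?S + s\<^sup>2 * \<bar>?S\<bar>" unfolding a3 by (simp add: distrib_right)
  qed
  finally show ?thesis by (simp add: excess_def)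
qed

text \<open>Cauchy-Schwarz over the \<open>n\<close> increments, without separating mean and
  fluctuation. The quadratic growth is affordable because the bound is used with the factor
  \<open>s ^ 4\<close>.\<close>

lemma walk_second_moment:
  assumes e: "norm e = 1"
  shows "integrable M (\<lambda>x. (walk n x \<bullet> e)\<^sup>2)"
    and "expectation (\<lambda>x. (walk n x \<bullet> e)\<^sup>2) \<le> (real n)\<^sup>2 * expectation (\<lambda>x. (norm (Z 0 x))\<^sup>2)"
proof -
  have le: "(walk n x \<bullet> e)\<^sup>2 \<le> n * (\<Sum>i<n. (norm (Z i x))\<^sup>2)" for x
  proof -
    have "(walk n x \<bullet> e)\<^sup>2 = (\<Sum>i<n. 1 * (Z i x \<bullet> e))\<^sup>2" by (simp add: walk_def inner_sum_left)
    also have "\<dots> \<le> (\<Sum>i<n. 1\<^sup>2) * (\<Sum>i<n. (Z i x \<bullet> e)\<^sup>2)" by (rule Cauchy_Schwarz_ineq_sum)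
    also have "\<dots> \<le> (\<Sum>i<n. 1\<^sup>2) * (\<Sum>i<n. (norm (Z i x))\<^sup>2)"
    proof (intro mult_left_mono sum_mono)
      fix i
      have "\<bar>Z i x \<bullet> e\<bar>\<^sup>2 \<le> (norm (Z i x))\<^sup>2"
        using Cauchy_Schwarz_ineq2[of "Z i x" e] e by (intro power_mono) auto
      then show "(Z i x \<bullet> e)\<^sup>2 \<le> (norm (Z i x))\<^sup>2" by simp
    qed simp
    finally show ?thesis by simp
  qed
  have int: "integrable M (\<lambda>x. n * (\<Sum>i<n. (norm (Z i x))\<^sup>2))"
    using integrable_norm_Z_sq by simp
  show int2: "integrable M (\<lambda>x. (walk n x \<bullet> e)\<^sup>2)"
    by (rule Bochner_Integration.integrable_bound[OF int]) (use le in \<open>auto simp: sum_nonneg\<close>)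
  have "expectation (\<lambda>x. (walk n x \<bullet> e)\<^sup>2) \<le> expectation (\<lambda>x. n * (\<Sum>i<n. (norm (Z i x))\<^sup>2))"
    by (rule integral_mono[OF int2 int le])
  also have "\<dots> = n * (\<Sum>i<n. expectation (\<lambda>x. (norm (Z i x))\<^sup>2))"
    using integrable_norm_Z_sq by simp
  also have "(\<Sum>i<n. expectation (\<lambda>x. (norm (Z i x))\<^sup>2)) = n * expectation (\<lambda>x. (norm (Z 0 x))\<^sup>2)"
  proof -
    have "expectation (\<lambda>x. (norm (Z i x))\<^sup>2) = expectation (\<lambda>x. (norm (Z 0 x))\<^sup>2)" for i
      by (rule integral_Z) simp
    then have "(\<Sum>i<n. expectation (\<lambda>x. (norm (Z i x))\<^sup>2)) = (\<Sum>i<n. expectation (\<lambda>x. (norm (Z 0 x))\<^sup>2))"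
      by (rule sum.cong[OF refl])
    then show ?thesis by simp
  qed
  finally show "expectation (\<lambda>x. (walk n x \<bullet> e)\<^sup>2) \<le> (real n)\<^sup>2 * expectation (\<lambda>x. (norm (Z 0 x))\<^sup>2)"
    by (simp add: power2_eq_square mult.assoc)
qed

lemma norm_tilted_le:
  assumes "mu \<noteq> 0" "0 \<le> s" "s \<le> 1" "\<bar>c\<bar> = 1"
  shows "norm (tilted c s) \<le> 2"
proof -
  have "norm (tilted c s) \<le> norm (s *\<^sub>R mu_dir) + norm (c *\<^sub>R perp mu_dir)"
    unfolding tilted_def by (rule norm_triangle_ineq)
  then show ?thesis using assms by (simp add: norm_perp norm_mu_dir)
qed

text \<open>Squaring a sum of four terms costs a factor 4. The three width errors enter with weights
  9, 1 and 1, and each has second moment at most \<open>4 * drift_bound\<close>, whence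
  \<open>176 = 4 * 11 * 4\<close>.\<close>

lemma excess_second_moment:
  assumes mu: "mu \<noteq> 0" and s: "0 \<le> s" "s \<le> 1" and y: "y \<ge> 0" and K: "K > 0"
  shows "integrable M (\<lambda>x. (excess n x)\<^sup>2)"
    and "expectation (\<lambda>x. (excess n x)\<^sup>2)
      \<le> 4 * s ^ 4 * (real n)\<^sup>2 * expectation (\<lambda>x. (norm (Z 0 x))\<^sup>2) + 176 * drift_bound n (s * norm mu) y K"
proof -
  define d where "d = s * norm mu"
  have d: "d \<ge> 0" using s by (simp add: d_def)
  define U where "U x = (s\<^sup>2 * (walk n x \<bullet> mu_dir))\<^sup>2" for x
  define V where "V x = (width_err mu_dir d n x)\<^sup>2" for x
  define V1 where "V1 x = (width_err (tilted 1 s) d n x)\<^sup>2" for x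
  define V2 where "V2 x = (width_err (tilted (- 1) s) d n x)\<^sup>2" for x
  note w0 = walk_second_moment[OF norm_mu_dir[OF mu], of n]
  have U: "integrable M U" "expectation U \<le> s ^ 4 * ((real n)\<^sup>2 * expectation (\<lambda>x. (norm (Z 0 x))\<^sup>2))"
    using w0 mult_left_mono[OF w0(2), of "s ^ 4"] by (auto simp: U_def[abs_def] power_mult_distrib)
  have V: "integrable M V" "expectation V \<le> 4 * drift_bound n d y K"
    using width_err_second_moment[OF _ d y K, of mu_dir n] norm_mu_dir[OF mu] by (simp_all add: V_def[abs_def])
  have V1: "integrable M V1" "expectation V1 \<le> 4 * drift_bound n d y K"
    using width_err_second_moment[OF norm_tilted_le[OF mu s, of 1] d y K, of n] by (simp_all add: V1_def[abs_def])
  have V2: "integrable M V2" "expectation V2 \<le> 4 * drift_bound n d y K"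
    using width_err_second_moment[OF norm_tilted_le[OF mu s, of "- 1"] d y K, of n] by (simp_all add: V2_def[abs_def])
  have four: "(p + q + r + t)\<^sup>2 \<le> 4 * (p\<^sup>2 + q\<^sup>2 + r\<^sup>2 + t\<^sup>2)" for p q r t :: real
  proof -
    have "4 * (p\<^sup>2 + q\<^sup>2 + r\<^sup>2 + t\<^sup>2) - (p + q + r + t)\<^sup>2
      = (p - q)\<^sup>2 + (p - r)\<^sup>2 + (p - t)\<^sup>2 + (q - r)\<^sup>2 + (q - t)\<^sup>2 + (r - t)\<^sup>2"
      by (simp add: power2_eq_square algebra_simps)
    moreover have "0 \<le> \<dots>" by (intro add_nonneg_nonneg zero_le_power2)
    ultimately show ?thesis by linarith
  qed
  have le: "(excess n x)\<^sup>2 \<le> 4 * (U x + 9 * V x + V1 x + V2 x)" for x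
  proof -
    have "(excess n x)\<^sup>2 \<le> (s\<^sup>2 * \<bar>walk n x \<bullet> mu_dir\<bar> + 3 * width_err mu_dir d n x
      + width_err (tilted 1 s) d n x + width_err (tilted (- 1) s) d n x)\<^sup>2"
      using excess_le[OF mu s, of n x] excess_nonneg[OF mu] unfolding d_def by (intro power_mono) auto
    also note four
    finally show ?thesis by (simp add: U_def V_def V1_def V2_def power_mult_distrib)
  qed
  have int: "integrable M (\<lambda>x. 4 * (U x + 9 * V x + V1 x + V2 x))" using U V V1 V2 by simp
  show int2: "integrable M (\<lambda>x. (excess n x)\<^sup>2)"
  proof (rule Bochner_Integration.integrable_bound[OF int])
    show "AE x in M. norm ((excess n x)\<^sup>2) \<le> norm (4 * (U x + 9 * V x + V1 x + V2 x))"
      using le by (intro AE_I2) (metis abs_of_nonneg order_trans real_norm_def zero_le_power2)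
  qed measurable
  have "expectation (\<lambda>x. (excess n x)\<^sup>2) \<le> expectation (\<lambda>x. 4 * (U x + 9 * V x + V1 x + V2 x))"
    by (rule integral_mono[OF int2 int le])
  also have "\<dots> = 4 * (expectation U + 9 * expectation V + expectation V1 + expectation V2)"
    using U V V1 V2 by simp
  finally show "expectation (\<lambda>x. (excess n x)\<^sup>2)
      \<le> 4 * s ^ 4 * (real n)\<^sup>2 * expectation (\<lambda>x. (norm (Z 0 x))\<^sup>2) + 176 * drift_bound n (s * norm mu) y K"
    using U(2) V(2) V1(2) V2(2) unfolding d_def[symmetric] by (simp add: mult.assoc)
qed

text \<open>The tilt \<open>s = n powr (-1/3)\<close> makes both error terms negligible: the length defect
  \<open>s\<^sup>2 n\<close> is \<open>o(sqrt n)\<close>, while the drift \<open>s \<bar>\<mu>\<bar>\<close> in the tilted directions is still strong enough to keep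
  the fluctuations \<open>o(sqrt n)\<close>.\<close>

lemma excess_negligible:
  assumes mu: "mu \<noteq> 0"
  shows "(\<lambda>n. expectation (\<lambda>x. (excess n x)\<^sup>2) / n) \<longlonglongrightarrow> 0"
proof (rule LIMSEQ_I)
  fix r :: real assume r: "r > 0"
  define m where "m = norm mu"
  have m: "m > 0" using mu by (simp add: m_def)
  define E where "E = expectation (\<lambda>x. (norm (Z 0 x))\<^sup>2)"
  \<comment> \<open>The tail enters the final estimate with the factor
    \<open>5632 = 176 * 32\<close>, so this choice keeps it below \<open>r / 2\<close>.\<close>
  have "\<forall>\<^sub>F k in sequentially. tail_var (real k) < r / 20000"
    using tail_var_tendsto_0 r by (intro order_tendstoD) auto
  then have "\<forall>\<^sub>F k in sequentially. tail_var (real k) < r / 20000 \<and> k > 0"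
    using eventually_gt_at_top[of 0] by (rule eventually_conj)
  then obtain k :: nat where k: "tail_var (real k) < r / 20000" "k > 0"
    by (auto dest!: eventually_happens'[OF sequentially_bot])
  define B where "B = 4 * real k"
  have B: "B > 0" using k by (simp add: B_def)
  \<comment> \<open>The threshold is \<open>y = n powr (2/5)\<close>: below \<open>sqrt n\<close>,
    so that \<open>y\<^sup>2 / n\<close> vanishes, and above the scale \<open>n powr (1/3)\<close>
    of \<open>1 / s\<close>, so that \<open>y * s\<close> grows like \<open>n powr (1/15)\<close>
    and the exponential beats every power of \<open>n\<close>.\<close>
  define g where "g n = 4 * E * ((real n powr (-1/3)) ^ 4 * (real n)\<^sup>2 / real n)
    + 352 * ((real n powr (2/5))\<^sup>2 / real n)
    + 352 * (real n ^ 3 * B\<^sup>2 * exp (- 2 * real n powr (2/5) * (real n powr (-1/3) * m) / B\<^sup>2) / real n)" for n :: nat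
  have g1: "(\<lambda>n. (real n powr (-1/3)) ^ 4 * (real n)\<^sup>2 / real n) \<longlonglongrightarrow> 0" by real_asymp
  have g2: "(\<lambda>n. (real n powr (2/5))\<^sup>2 / real n) \<longlonglongrightarrow> 0" by real_asymp
  have g3: "(\<lambda>n. real n ^ 3 * B\<^sup>2 * exp (- 2 * real n powr (2/5) * (real n powr (-1/3) * m) / B\<^sup>2) / real n) \<longlonglongrightarrow> 0"
    using B m by real_asymp
  have "g \<longlonglongrightarrow> 4 * E * 0 + 352 * 0 + 352 * 0"
    unfolding g_def[abs_def]
    by (rule tendsto_add[OF tendsto_add[OF tendsto_mult_left[OF g1] tendsto_mult_left[OF g2]] tendsto_mult_left[OF g3]])
  then have "\<forall>\<^sub>F n in sequentially. g n < r / 2" using r by (intro order_tendstoD) auto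
  then have "\<forall>\<^sub>F n in sequentially. norm (expectation (\<lambda>x. (excess n x)\<^sup>2) / n - 0) < r"
    using eventually_gt_at_top[of 0]
  proof eventually_elim
    case (elim n)
    have n: "real n \<ge> 1" using elim by simp
    define s where "s = real n powr (-1/3)"
    have s: "0 \<le> s" "s \<le> 1" using powr_mono[of "-1/3" 0 "real n"] n by (auto simp: s_def)
    have "expectation (\<lambda>x. (excess n x)\<^sup>2) \<le> 4 * s ^ 4 * (real n)\<^sup>2 * E
        + 176 * drift_bound n (s * m) (real n powr (2/5)) (real k)"
      unfolding E_def m_def by (rule excess_second_moment[OF mu s]) (use k in auto)
    then have "expectation (\<lambda>x. (excess n x)\<^sup>2) / n \<le> (4 * s ^ 4 * (real n)\<^sup>2 * E
        + 176 * drift_bound n (s * m) (real n powr (2/5)) (real k)) / n"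
      by (rule divide_right_mono) simp
    also have "\<dots> = g n + 5632 * tail_var (real k)"
      using n by (simp add: g_def drift_bound_def s_def B_def add_divide_distrib distrib_left mult_ac)
    also have "\<dots> < r" using elim k r by linarith
    finally have "expectation (\<lambda>x. (excess n x)\<^sup>2) / n < r" .
    moreover have "0 \<le> expectation (\<lambda>x. (excess n x)\<^sup>2) / n" by simp
    ultimately show ?case by simp
  qed
  then show "\<exists>N. \<forall>n\<ge>N. norm (expectation (\<lambda>x. (excess n x)\<^sup>2) / n - 0) < r"
    by (simp add: eventually_sequentially)
qed

section \<open>The central limit theorem for the perimeter\<close>

text \<open>The factor 2 reflects that a long thin hull is traversed in both directions; with it the
  second moment is exactly the constant \<sigma>2 of the theorem.\<close>

definition fluct :: "nat \<Rightarrow> 'a \<Rightarrow> real" where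
  "fluct i x = 2 * ((Z i x - mu) \<bullet> mu_dir)"

lemma fluct_measurable [measurable]: "fluct i \<in> borel_measurable M"
  unfolding fluct_def[abs_def] by measurable

lemma indep_fluct: "indep_vars (\<lambda>_. borel) fluct UNIV"
  unfolding fluct_def[abs_def] by (rule indep_vars_compose2[OF indep]) simp

lemma distr_fluct: "distr M borel (fluct i) = distr M borel (fluct 0)"
proof -
  have "distr M borel (fluct j) = distr (distr M borel (Z j)) borel (\<lambda>z. 2 * ((z - mu) \<bullet> mu_dir))" for j
    by (subst distr_distr) (simp_all add: comp_def fluct_def[abs_def])
  then show ?thesis using ident[of i] by simp
qed

lemma integrable_fluct_sq: "integrable M (\<lambda>x. (fluct i x)\<^sup>2)"
proof -
  have 1: "integrable M (\<lambda>x. (Z i x \<bullet> (2 *\<^sub>R mu_dir))\<^sup>2)"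
  proof (rule integrable_square_of_norm_le[where C = "norm (2 *\<^sub>R mu_dir)"])
    show "\<bar>z \<bullet> (2 *\<^sub>R mu_dir)\<bar> \<le> norm (2 *\<^sub>R mu_dir) * norm z" for z :: "real^2"
      by (subst mult.commute) (rule Cauchy_Schwarz_ineq2)
  qed measurable
  have "integrable M (\<lambda>x. (Z i x \<bullet> (2 *\<^sub>R mu_dir) + - (mu \<bullet> (2 *\<^sub>R mu_dir)))\<^sup>2)"
    by (rule integrable_square_add) (use 1 in auto)
  then show ?thesis by (simp add: fluct_def inner_diff_left right_diff_distrib)
qed

lemma expectation_fluct: "expectation (fluct i) = 0"
  using integrable_Z[of i] expectation_Z[of i] unfolding fluct_def[abs_def]
  by (simp add: prob_space)

lemma sum_fluct: "(\<Sum>i<n. fluct i x) = 2 * (walk n x \<bullet> mu_dir) - 2 * (n * (mu \<bullet> mu_dir))"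
  by (simp add: fluct_def walk_def inner_sum_left inner_diff_left sum_subtractf sum_distrib_left right_diff_distrib)

lemma integrable_walk_inner: "integrable M (\<lambda>x. walk n x \<bullet> e)"
  unfolding walk_def using integrable_Z by simp

lemma expectation_walk_inner: "expectation (\<lambda>x. walk n x \<bullet> e) = n * (mu \<bullet> e)"
  unfolding walk_def inner_sum_left using integrable_Z expectation_Z by simp

text \<open>\<open>A\<close> is the normalised sum of the fluctuations, \<open>B\<close> the centred
  perimeter on the same scale, and \<open>C\<close> the perimeter standardised by its own variance.
  \<open>B - A\<close> is the centred excess divided by \<open>sqrt (s2 * n)\<close>, which is
  negligible in mean square; the same fact makes the variance asymptotic to \<open>s2 * n\<close>,
  so that \<open>C - B\<close> is negligible too.\<close>

theorem perimeter_CLT: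
  assumes mu: "mu \<noteq> 0" and s2: "expectation (\<lambda>x. (fluct 0 x)\<^sup>2) = s2" and pos: "s2 > 0"
  shows "(\<lambda>n. prob {x \<in> space M. (perimeter n x - expectation (perimeter n)) / sqrt (variance (perimeter n)) \<le> t})
      \<longlonglongrightarrow> cdf std_normal_distribution t"
    and "(\<lambda>n. prob {x \<in> space M. (perimeter n x - expectation (perimeter n)) / sqrt (s2 * n) \<le> t})
      \<longlonglongrightarrow> cdf std_normal_distribution t"
proof -
  define A where "A n x = (\<Sum>i<n. fluct i x) / sqrt (s2 * n)" for n :: nat and x
  define B where "B n x = (perimeter n x - expectation (perimeter n)) / sqrt (s2 * n)" for n :: nat and x
  define C where "C n x = (perimeter n x - expectation (perimeter n)) / sqrt (variance (perimeter n))" for n :: nat and x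
  have A[measurable]: "A n \<in> borel_measurable M" for n unfolding A_def[abs_def] by measurable
  have B[measurable]: "B n \<in> borel_measurable M" for n unfolding B_def[abs_def] by measurable
  have C[measurable]: "C n \<in> borel_measurable M" for n unfolding C_def[abs_def] by measurable
  have Esq: "expectation (\<lambda>x. (fluct i x)\<^sup>2) = s2" for i
  proof -
    have "expectation (\<lambda>x. (fluct i x)\<^sup>2) = (\<integral>y. y\<^sup>2 \<partial>distr M borel (fluct i))" for i
      by (simp add: integral_distr)
    then show ?thesis using s2 distr_fluct[of i] by simp
  qed
  \<comment> \<open>Only integrability is wanted, so any admissible \<open>s\<close>,
    \<open>y\<close> and \<open>K\<close> will do.\<close>
  have exint2: "integrable M (\<lambda>x. (excess n x)\<^sup>2)" for n
    by (rule excess_second_moment(1)[OF mu, of 1 0 1]) simp_all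
  have exint: "integrable M (excess n)" for n
    by (rule square_integrable_imp_integrable[OF _ exint2]) simp
  have per: "perimeter n x = excess n x + 2 * (walk n x \<bullet> mu_dir)" for n x by (simp add: excess_def)
  have Eper: "expectation (perimeter n) = expectation (excess n) + 2 * (n * (mu \<bullet> mu_dir))" for n
    unfolding per[abs_def] using exint integrable_walk_inner by (simp add: expectation_walk_inner)
  have diff: "B n x - A n x = (excess n x - expectation (excess n)) / sqrt (s2 * n)" for n x
    unfolding A_def B_def sum_fluct Eper per diff_divide_distrib[symmetric] by simp
  have diffsq: "(B n x - A n x)\<^sup>2 = (excess n x - expectation (excess n))\<^sup>2 / (s2 * n)" for n x
    unfolding diff power_divide using pos by simp
  have exc2: "integrable M (\<lambda>x. (excess n x - expectation (excess n))\<^sup>2)" for n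
    unfolding power2_diff using exint exint2 by simp
  have intBA: "integrable M (\<lambda>x. (B n x - A n x)\<^sup>2)" for n
    unfolding diffsq using exc2 by simp
  have err: "(\<lambda>n. expectation (\<lambda>x. (B n x - A n x)\<^sup>2)) \<longlonglongrightarrow> 0"
  proof (rule Lim_null_comparison)
    show "(\<lambda>n. expectation (\<lambda>x. (excess n x)\<^sup>2) / n / s2) \<longlonglongrightarrow> 0"
      using tendsto_divide[OF excess_negligible[OF mu] tendsto_const, of s2] pos by simp
    \<comment> \<open>This includes \<open>n = 0\<close>, where division by zero makes both sides
      0.\<close>
    have "expectation (\<lambda>x. (B n x - A n x)\<^sup>2) \<le> expectation (\<lambda>x. (excess n x)\<^sup>2) / n / s2" for n
    proof -
      have "expectation (\<lambda>x. (B n x - A n x)\<^sup>2) = variance (excess n) / (s2 * n)"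
        unfolding diffsq by simp
      also have "\<dots> \<le> expectation (\<lambda>x. (excess n x)\<^sup>2) / (s2 * n)"
        using variance_eq[OF exint exint2] pos by (intro divide_right_mono) auto
      finally show ?thesis by (simp add: mult.commute)
    qed
    then show "\<forall>\<^sub>F n in sequentially. norm (expectation (\<lambda>x. (B n x - A n x)\<^sup>2)) \<le> expectation (\<lambda>x. (excess n x)\<^sup>2) / n / s2"
      by (intro always_eventually allI) simp
  qed
  have "weak_conv_m (\<lambda>n. distr M borel (\<lambda>x. (\<Sum>i<n. fluct i x) / sqrt (n * (sqrt s2)\<^sup>2))) std_normal_distribution"
    by (rule central_limit_theorem_zero_mean[OF indep_fluct expectation_fluct _ integrable_fluct_sq _ distr_fluct])
      (use pos in \<open>simp_all add: expectation_fluct Esq\<close>)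
  then have wc: "weak_conv_m (\<lambda>n. distr M borel (A n)) std_normal_distribution"
    using pos by (simp add: A_def[abs_def] mult.commute)
  have limA: "(\<lambda>n. prob {x \<in> space M. A n x \<le> z}) \<longlonglongrightarrow> cdf std_normal_distribution z" for z
  proof -
    have eq: "cdf (distr M borel (A n)) z = prob {x \<in> space M. A n x \<le> z}" for n
      unfolding cdf_def by (subst measure_distr) (auto intro!: arg_cong[where f = prob])
    have "(\<lambda>n. cdf (distr M borel (A n)) z) \<longlonglongrightarrow> cdf std_normal_distribution z"
      using wc isCont_cdf_std_normal by (simp add: weak_conv_m_def weak_conv_def)
    then show ?thesis unfolding eq .
  qed
  show "(\<lambda>n. prob {x \<in> space M. (perimeter n x - expectation (perimeter n)) / sqrt (s2 * n) \<le> t})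
      \<longlonglongrightarrow> cdf std_normal_distribution t"
    using Slutsky_L2[OF A B limA isCont_cdf_std_normal intBA err, of t] unfolding B_def .

  have fsum2: "integrable M (\<lambda>x. (\<Sum>i<n. fluct i x)\<^sup>2)" for n
    by (rule integrable_square_sum) (use integrable_fluct_sq in auto)
  have intA2: "integrable M (\<lambda>x. (A n x)\<^sup>2)" for n
    unfolding A_def power_divide using fsum2 by simp
  have EA2: "expectation (\<lambda>x. (A n x)\<^sup>2) = 1" if "n > 0" for n
  proof -
    have "expectation (\<lambda>x. (\<Sum>i<k. fluct i x)\<^sup>2) = k * s2" for k
    proof (induction k)
      case (Suc k)
      have m: "(\<lambda>f. \<Sum>i<k. f i) \<in> borel_measurable (PiM {..<k} (\<lambda>_. borel :: real measure))" by measurable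
      have r: "(\<Sum>i<k. (\<lambda>i\<in>{..<k}. fluct i x) i) = (\<Sum>i<k. fluct i x)" for x by (rule sum.cong) auto
      note past = indep_vars_expectation_past_mult[OF indep_fluct expectation_fluct integrable_fluct_sq m, unfolded r, OF fsum2]
      have "expectation (\<lambda>x. (\<Sum>i<Suc k. fluct i x)\<^sup>2)
        = expectation (\<lambda>x. (\<Sum>i<k. fluct i x)\<^sup>2 + (fluct k x)\<^sup>2 + 2 * ((\<Sum>i<k. fluct i x) * fluct k x))"
        by (simp add: power2_sum mult.assoc)
      also have "\<dots> = expectation (\<lambda>x. (\<Sum>i<k. fluct i x)\<^sup>2) + expectation (\<lambda>x. (fluct k x)\<^sup>2)"
        using past fsum2 integrable_fluct_sq by simp
      finally show ?case using Suc Esq by (simp add: algebra_simps)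
    qed simp
    then show ?thesis unfolding A_def power_divide using that pos by simp
  qed
  have limA2: "(\<lambda>n. expectation (\<lambda>x. (A n x)\<^sup>2)) \<longlonglongrightarrow> 1"
    by (rule tendsto_eventually) (use EA2 in \<open>auto intro: eventually_mono[OF eventually_gt_at_top[of 0]]\<close>)
  \<comment> \<open>For \<open>n > 0\<close> this is the ratio of the variance of the perimeter to
    \<open>s2 * n\<close>; its limit 1 is what allows the scales to be exchanged.\<close>
  define q where "q n = expectation (\<lambda>x. (B n x)\<^sup>2)" for n
  have q: "q \<longlonglongrightarrow> 1"
    using second_moment_perturbation[OF A B intA2 intBA limA2 err] unfolding q_def .
  have intB2: "integrable M (\<lambda>x. (B n x)\<^sup>2)" for n
    using integrable_square_add[OF A _ intA2 intBA, of n n] by simp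
  have qv: "variance (perimeter n) = q n * (s2 * n)" if "n > 0" for n
  proof -
    have "q n = variance (perimeter n) / (s2 * n)"
      unfolding q_def B_def power_divide using pos by simp
    then show ?thesis using that pos by simp
  qed
  have CB: "C n x = B n x / sqrt (q n)" if "n > 0" for n x
    unfolding C_def B_def qv[OF that] by (simp add: real_sqrt_mult mult.commute)
  have intCB: "integrable M (\<lambda>x. (C n x - B n x)\<^sup>2)" for n
  proof -
    have "perimeter n x - expectation (perimeter n) = (excess n x - expectation (excess n)) + (\<Sum>i<n. fluct i x)" for x
      unfolding sum_fluct Eper per by simp
    then have "integrable M (\<lambda>x. (perimeter n x - expectation (perimeter n))\<^sup>2)"
      using integrable_square_add[OF _ _ exc2 fsum2, of n n] by simp
    then have "integrable M (\<lambda>x. (1 / sqrt (variance (perimeter n)) - 1 / sqrt (s2 * n))\<^sup>2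
        * (perimeter n x - expectation (perimeter n))\<^sup>2)"
      by simp
    then show ?thesis unfolding power_mult_distrib[symmetric] by (simp add: C_def B_def left_diff_distrib)
  qed
  have q0: "\<forall>\<^sub>F n in sequentially. q n > 0 \<and> n > 0"
    using order_tendstoD(1)[OF q, of 0] eventually_gt_at_top[of 0] by (auto intro: eventually_conj)
  have "(\<lambda>n. expectation (\<lambda>x. (C n x - B n x)\<^sup>2)) \<longlonglongrightarrow> 0"
  proof (rule Lim_transform_eventually)
    have "(\<lambda>n. (1 - sqrt (q n))\<^sup>2) \<longlonglongrightarrow> (1 - sqrt 1)\<^sup>2"
      by (intro tendsto_power tendsto_diff tendsto_const tendsto_real_sqrt q)
    then show "(\<lambda>n. (1 - sqrt (q n))\<^sup>2) \<longlonglongrightarrow> 0" by simp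
    show "\<forall>\<^sub>F n in sequentially. (1 - sqrt (q n))\<^sup>2 = expectation (\<lambda>x. (C n x - B n x)\<^sup>2)"
      using q0
    proof eventually_elim
      case (elim n)
      \<comment> \<open>\<open>C n\<close> is a deterministic multiple of \<open>B n\<close>, and
        \<open>B n\<close> has second moment \<open>q n\<close>, so the error is an explicit
        function of \<open>q n\<close> that vanishes at 1.\<close>
      have "C n x - B n x = (1 / sqrt (q n) - 1) * B n x" for x
        using elim by (simp add: CB left_diff_distrib)
      then have "expectation (\<lambda>x. (C n x - B n x)\<^sup>2) = (1 / sqrt (q n) - 1)\<^sup>2 * q n"
        by (simp add: power_mult_distrib q_def)
      also have "\<dots> = ((1 / sqrt (q n) - 1) * sqrt (q n))\<^sup>2"
        using elim by (simp add: power_mult_distrib)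
      also have "(1 / sqrt (q n) - 1) * sqrt (q n) = 1 - sqrt (q n)"
        using elim by (simp add: left_diff_distrib)
      finally show ?case ..
    qed
  qed
  \<comment> \<open>The premise left open, convergence for \<open>B\<close> at every point, is
    supplied by the earlier comparison with \<open>A\<close>.\<close>
  from Slutsky_L2[OF B C _ isCont_cdf_std_normal intCB this, of t]
  show "(\<lambda>n. prob {x \<in> space M. (perimeter n x - expectation (perimeter n)) / sqrt (variance (perimeter n)) \<le> t})
      \<longlonglongrightarrow> cdf std_normal_distribution t"
    using Slutsky_L2[OF A B limA isCont_cdf_std_normal intBA err] unfolding C_def by simp
qed

end

theorem theorem1p2:
  fixes M :: "'a measure"
    and Z :: "nat \<Rightarrow> 'a \<Rightarrow> real^2"
    and S :: "nat \<Rightarrow> 'a \<Rightarrow> real^2"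
    and L :: "nat \<Rightarrow> 'a \<Rightarrow> real"
    and \<mu> :: "real^2"
    and \<sigma>2 :: real
  assumes "prob_space M"
    and indep: "prob_space.indep_vars M (\<lambda>i. borel) Z UNIV"
    and ident: "\<And>i. distr M borel (Z i) = distr M borel (Z 0)"
    and sq_int: "integrable M (\<lambda>\<omega>. (norm (Z 0 \<omega>))\<^sup>2)"
    and mu_def: "\<mu> = (\<integral>\<omega>. Z 0 \<omega> \<partial>M)"
    and mu_nz: "norm \<mu> \<noteq> 0"
    and S_def: "\<And>n \<omega>. S n \<omega> = (\<Sum>i<n. Z i \<omega>)"
    and L_def: "\<And>n \<omega>. L n \<omega> = hull_perimeter {S k \<omega> | k. k \<le> n}"
    and sigma_def: "\<sigma>2 = 4 * (\<integral>\<omega>. ((Z 0 \<omega> - \<mu>) \<bullet> \<mu>)\<^sup>2 \<partial>M) / (norm \<mu>)\<^sup>2"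
    and sigma_pos: "\<sigma>2 > 0"
  shows "\<forall>x::real.
     ((\<lambda>n. measure M {\<omega> \<in> space M.
          (L n \<omega> - (\<integral>\<omega>'. L n \<omega>' \<partial>M)) /
            sqrt (\<integral>\<omega>'. (L n \<omega>' - (\<integral>\<omega>''. L n \<omega>'' \<partial>M))\<^sup>2 \<partial>M) \<le> x})
        \<longlonglongrightarrow> cdf std_normal_distribution x) \<and>
     ((\<lambda>n. measure M {\<omega> \<in> space M.
          (L n \<omega> - (\<integral>\<omega>'. L n \<omega>' \<partial>M)) / sqrt (\<sigma>2 * real n) \<le> x})
        \<longlonglongrightarrow> cdf std_normal_distribution x)"
proof -
  interpret prob_space M by fact
  interpret planar_walk M Z by unfold_locales (fact indep, fact ident, fact sq_int)
  have mu: "mu = \<mu>" by (simp add: planar_walk.mu_def planar_walk_axioms assms(5))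
  have L: "L n = perimeter n" for n
  proof
    fix \<omega>
    have "{S k \<omega> | k. k \<le> n} = (\<lambda>k. walk k \<omega>) ` {..n}" by (auto simp: S_def walk_def)
    then show "L n \<omega> = perimeter n \<omega>" by (simp add: L_def perimeter_def)
  qed
  have "(fluct 0 x)\<^sup>2 = 4 / (norm \<mu>)\<^sup>2 * ((Z 0 x - \<mu>) \<bullet> \<mu>)\<^sup>2" for x
    by (simp add: fluct_def mu_dir_def mu power_mult_distrib power_divide divide_inverse power_inverse)
  then have "expectation (\<lambda>x. (fluct 0 x)\<^sup>2) = \<sigma>2" by (simp add: sigma_def)
  moreover have "mu \<noteq> 0" using mu_nz mu by auto
  ultimately show ?thesis
    unfolding L using perimeter_CLT sigma_pos by blast
qed

end
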